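(* Let $k_1<\dots<k_n$ be integers. Then $$\sum_M \mathrm{W}_0(M)=\prod_{1\le p<q\le n}\left(u\,E_{k_p}+v\,E_{k_q}^{-1}+w\,E_{k_p}E_{k_q}^{-1}\right)s_{(k_n,\dots,k_1)}(X_1,\dots,X_n),$$ the sum being over all monotone triangles $M$ with bottom row $(k_1,\dots,k_n)$, and the operator expression interpreted by expanding the operator product, applying it to $(k_1,\dots,k_n)\mapsto s_{(k_n,\dots,k_1)}$ viewed as a function on $\mathbb{Z}^n$, and then evaluating at the given $k_i$.
   Context: A monotone triangle $M=(m_{i,j})_{1\le j\le i\le n}$ is an array of integers with $m_{i+1,j}\le m_{i,j}\le m_{i+1,j+1}$ and $m_{i,j}<m_{i,j+1}$; row $n$ is the bottom row. An entry $m_{i,j}$ with $i<n$ is special if $m_{i+1,j}<m_{i,j}<m_{i+1,j+1}$, left-leaning if $m_{i,j}=m_{i+1,j}$, right-leaning if $m_{i,j}=m_{i+1,j+1}$. Let $s_i,l_i,r_i$ be the numbers of special, left-leaning, right-leaning entries in row $i$ ($1\le i\le n-1$), $s_0=l_0=r_0=0$, and $l(M)=\sum l_i$, $r(M)=\sum r_i$. Put $d_i(M)=\sum_{j=1}^i m_{i,j}-\sum_{j=1}^{i-1}m_{i-1,j}+r_{i-1}(M)-l_{i-1}(M)$. The weight is $\mathrm{W}_0(M)=u^{r(M)}v^{l(M)}\prod_{i=1}^nX_i^{d_i(M)}(w+uX_i+vX_i^{-1})^{s_{i-1}(M)}$. $E_x$ is the shift operator $E_xp(x)=p(x+1)$.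 Extended Schur polynomial: for $\lambda\in\mathbb{Z}^n$, $s_\lambda=0$ if $\lambda_i-i=\lambda_j-j$ for some $i<j$; otherwise with $\sigma$ such that $\lambda_{\sigma(1)}-\sigma(1)>\dots>\lambda_{\sigma(n)}-\sigma(n)$ and an integer $p\ge0$ with $\lambda_{\sigma(n)}+n-\sigma(n)+p\ge0$, $s_\lambda=\operatorname{sgn}(\sigma)s_\mu\prod_iX_i^{-p}$ where $\mu_i=\lambda_{\sigma(i)}+i-\sigma(i)+p$ and $s_\mu$ is the ordinary Schur polynomial. *)

theory Defs
  imports "HOL-Combinatorics.Permutations"
begin

text \<open>A monotone triangle with n rows is represented by a function M :: nat => nat => int,
  where M i j is the entry in row i, position j (1 <= j <= i <= n); entries outside this
  index range are fixed to 0 so that the representation is unique.  The bottom row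
  (row n) is given by k 1, ..., k n.\<close>

definition monotone_triangle :: "nat \<Rightarrow> (nat \<Rightarrow> int) \<Rightarrow> (nat \<Rightarrow> nat \<Rightarrow> int) \<Rightarrow> bool" where
  "monotone_triangle n k M \<longleftrightarrow>
     (\<forall>i j. \<not> (1 \<le> j \<and> j \<le> i \<and> i \<le> n) \<longrightarrow> M i j = 0) \<and>
     (\<forall>j. 1 \<le> j \<and> j \<le> n \<longrightarrow> M n j = k j) \<and>
     (\<forall>i j. 1 \<le> j \<and> j \<le> i \<and> i < n \<longrightarrow> M (i+1) j \<le> M i j \<and> M i j \<le> M (i+1) (j+1)) \<and>
     (\<forall>i j. 1 \<le> j \<and> j < i \<and> i \<le> n \<longrightarrow> M i j < M i (j+1))"

definition s_row :: "(nat \<Rightarrow> nat \<Rightarrow> int) \<Rightarrow> nat \<Rightarrow> nat" where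
  "s_row M i = card {j. 1 \<le> j \<and> j \<le> i \<and> M (i+1) j < M i j \<and> M i j < M (i+1) (j+1)}"

definition l_row :: "(nat \<Rightarrow> nat \<Rightarrow> int) \<Rightarrow> nat \<Rightarrow> nat" where
  "l_row M i = card {j. 1 \<le> j \<and> j \<le> i \<and> M i j = M (i+1) j}"

definition r_row :: "(nat \<Rightarrow> nat \<Rightarrow> int) \<Rightarrow> nat \<Rightarrow> nat" where
  "r_row M i = card {j. 1 \<le> j \<and> j \<le> i \<and> M i j = M (i+1) (j+1)}"

definition l_total :: "nat \<Rightarrow> (nat \<Rightarrow> nat \<Rightarrow> int) \<Rightarrow> nat" where
  "l_total n M = (\<Sum>i=1..n-1. l_row M i)"

definition r_total :: "nat \<Rightarrow> (nat \<Rightarrow> nat \<Rightarrow> int) \<Rightarrow> nat" where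
  "r_total n M = (\<Sum>i=1..n-1. r_row M i)"

definition d_row :: "(nat \<Rightarrow> nat \<Rightarrow> int) \<Rightarrow> nat \<Rightarrow> int" where
  "d_row M i = (\<Sum>j=1..i. M i j) - (\<Sum>j=1..i-1. M (i-1) j)
               + int (r_row M (i-1)) - int (l_row M (i-1))"

definition W0 :: "nat \<Rightarrow> 'a::field \<Rightarrow> 'a \<Rightarrow> 'a \<Rightarrow> (nat \<Rightarrow> 'a) \<Rightarrow> (nat \<Rightarrow> nat \<Rightarrow> int) \<Rightarrow> 'a" where
  "W0 n u v w X M = u ^ r_total n M * v ^ l_total n M *
     (\<Prod>i=1..n. X i powi d_row M i * (w + u * X i + v * inverse (X i)) ^ s_row M (i-1))"

definition yd_cells :: "nat \<Rightarrow> (nat \<Rightarrow> nat) \<Rightarrow> (nat \<times> nat) set" where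
  "yd_cells n mu = {(a,b). 1 \<le> a \<and> a \<le> n \<and> 1 \<le> b \<and> b \<le> mu a}"

definition ssyt :: "nat \<Rightarrow> (nat \<Rightarrow> nat) \<Rightarrow> (nat \<Rightarrow> nat \<Rightarrow> nat) set" where
  "ssyt n mu = {T. (\<forall>a b. (a,b) \<notin> yd_cells n mu \<longrightarrow> T a b = 0) \<and>
      (\<forall>a b. (a,b) \<in> yd_cells n mu \<longrightarrow> 1 \<le> T a b \<and> T a b \<le> n) \<and>
      (\<forall>a b. (a,b) \<in> yd_cells n mu \<and> (a,b+1) \<in> yd_cells n mu \<longrightarrow> T a b \<le> T a (b+1)) \<and>
      (\<forall>a b. (a,b) \<in> yd_cells n mu \<and> (a+1,b) \<in> yd_cells n mu \<longrightarrow> T a b < T (a+1) b)}"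

definition schur :: "nat \<Rightarrow> (nat \<Rightarrow> nat) \<Rightarrow> (nat \<Rightarrow> 'a::comm_ring_1) \<Rightarrow> 'a" where
  "schur n mu X = (\<Sum>T\<in>ssyt n mu. \<Prod>(a,b)\<in>yd_cells n mu. X (T a b))"

text \<open>Extended Schur polynomial for lam in Z^n (lam 1, ..., lam n); p is chosen as the
  least admissible nonnegative integer.\<close>
definition ext_schur :: "nat \<Rightarrow> (nat \<Rightarrow> int) \<Rightarrow> (nat \<Rightarrow> 'a::field) \<Rightarrow> 'a" where
  "ext_schur n lam X =
    (if \<exists>i j. 1 \<le> i \<and> i < j \<and> j \<le> n \<and> lam i - int i = lam j - int j then 0
     else
       (let \<sigma> = (THE \<sigma>. \<sigma> permutes {1..n} \<and>
                   (\<forall>i j. 1 \<le> i \<and> i < j \<and> j \<le> n \<longrightarrow>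
                       lam (\<sigma> i) - int (\<sigma> i) > lam (\<sigma> j) - int (\<sigma> j)));
            p = nat (- (lam (\<sigma> n) + int n - int (\<sigma> n)));
            mu = (\<lambda>i. nat (lam (\<sigma> i) + int i - int (\<sigma> i) + int p))
        in of_int (sign \<sigma>) * schur n mu X * (\<Prod>i=1..n. X i powi (- int p))))"

text \<open>The operator u E_p + v E_q^{-1} + w E_p E_q^{-1} acting on functions Z^n -> 'a
  (points of Z^n represented as nat => int, coordinates 1..n).\<close>
definition pair_op :: "'a::field \<Rightarrow> 'a \<Rightarrow> 'a \<Rightarrow> nat \<Rightarrow> nat \<Rightarrow>
    ((nat \<Rightarrow> int) \<Rightarrow> 'a) \<Rightarrow> ((nat \<Rightarrow> int) \<Rightarrow> 'a)" where
  "pair_op u v w p q f = (\<lambda>m. u * f (m(p := m p + 1)) + v * f (m(q := m q - 1))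
                              + w * f (m(p := m p + 1, q := m q - 1)))"

definition index_pairs :: "nat \<Rightarrow> (nat \<times> nat) list" where
  "index_pairs n = [(p,q). p \<leftarrow> [1..<n+1], q \<leftarrow> [1..<n+1], p < q]"

text \<open>The product over 1 <= p < q <= n of the pair operators (they commute).\<close>
definition op_product :: "nat \<Rightarrow> 'a::field \<Rightarrow> 'a \<Rightarrow> 'a \<Rightarrow>
    ((nat \<Rightarrow> int) \<Rightarrow> 'a) \<Rightarrow> ((nat \<Rightarrow> int) \<Rightarrow> 'a)" where
  "op_product n u v w f = foldr (\<lambda>(p,q) g. pair_op u v w p q g) (index_pairs n) f"

end

(* Work in the coordinates x_i = k_i + i, where the extended Schur function becomes alternating
   in x. Summing an alternating function a over a row interlacing with x is
   T a (x) = sum_j (-1)^(j-1) alpha(x without x_j), with alpha an alternating antidifference of a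
   in every variable, and this formula makes sense for all integer x. Let
   R_pq = u E_p + v E_q^-1 + w E_p E_q^-1, P = v + (u + w) E and Q = u + (v + w) E^-1.
   The product of all R_pq, applied to alpha(x without x_j), acts as P_i for i < j, as Q_i for
   i >= j, times the product for one variable fewer.
   The weighted sum over strictly increasing interlacing rows yields the same expression by
   summing one coordinate after the other: each summation picks Q at its right or -P at its left end
   point, and the terms with Q_i and P_(i+1) at the same point cancel against the correction for
   the forbidden case of equal neighbours, because
     Q_i P_j + u v (1 - E_i^-1)(E_j - 1) = (u + v + w) R_ji
   and R_ji times the full operator product is symmetric in i and j = i + 1, hence preserves
   alternating functions. So both sides of the theorem obey the same recursion in n.
   The case u = w = 0, v = 1 of this recursion is the branching rule which identifies the recursively
   defined T-iterates with Schur polynomials. *)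

theory Submission
  imports Defs "HOL-Library.Poly_Mapping" "HOL-Library.Function_Algebras"
begin

subsection \<open>Laurent polynomials in shift operators\<close>

text \<open>The operators move k out of the region where triangles with bottom row k exist, so both
  sides cannot be compared inside that region. Continuing the Schur side to all integer points by
  antidifferences removes this obstacle; the price is that the row sums must be recovered at the
  end. There strictness of k enters: consecutive shifted coordinates differ by at least 2, so the
  two end points of a summation interval are distinct and carry their own weights. The operators P
  and Q arise from R because a shift of the removed coordinate acts as 1. The new variable X
  disappears from each step: conjugation by X^(sum of coordinates) turns u and v into u X and v / X
  and fixes w, so only constant weights have to be summed.\<close>

type_synonym 'a laurent = "(nat \<Rightarrow> int) \<Rightarrow>\<^sub>0 'a"

text \<open>With exponent vectors as keys, the convolution product of \<open>Poly_Mapping\<close> is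
  composition of operators (\<open>act_mult\<close>). Operators thus form a commutative ring:
  products over sets of pairs need no order, and operator identities are plain ring algebra.\<close>

definition act :: "'a::field laurent \<Rightarrow> ((nat \<Rightarrow> int) \<Rightarrow> 'a) \<Rightarrow> (nat \<Rightarrow> int) \<Rightarrow> 'a" where
  "act L f m = (\<Sum>d\<in>Poly_Mapping.keys L. Poly_Mapping.lookup L d * f (m + d))"

lemma act_superset:
  assumes "finite A" "Poly_Mapping.keys L \<subseteq> A"
  shows "act L f m = (\<Sum>d\<in>A. Poly_Mapping.lookup L d * f (m + d))"
  unfolding act_def
  by (rule sum.mono_neutral_left) (use assms in \<open>auto simp: in_keys_iff\<close>)

lemma act_add: "act (L + M) f m = act L f m + act M f m"
proof -
  have "Poly_Mapping.keys (L + M) \<subseteq> Poly_Mapping.keys L \<union> Poly_Mapping.keys M" by (rule keys_add)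
  then show ?thesis
    by (simp add: act_superset[of "Poly_Mapping.keys L \<union> Poly_Mapping.keys M"] lookup_add distrib_right sum.distrib)
qed

lemma act_zero [simp]: "act 0 f m = 0"
  by (simp add: act_def)

lemma act_sum: "act (\<Sum>i\<in>I. L i) f m = (\<Sum>i\<in>I. act (L i) f m)"
  by (induction I rule: infinite_finite_induct) (auto simp: act_add)

lemma act_single: "act (Poly_Mapping.single d c) f m = c * f (m + d)"
  by (cases "c = 0") (simp_all add: act_def)

lemma poly_mapping_sum_single: "(L :: 'b \<Rightarrow>\<^sub>0 'c::comm_monoid_add) = (\<Sum>d\<in>Poly_Mapping.keys L. Poly_Mapping.single d (Poly_Mapping.lookup L d))"
proof (rule poly_mapping_eqI)
  fix k
  have "(\<Sum>d\<in>Poly_Mapping.keys L. Poly_Mapping.lookup (Poly_Mapping.single d (Poly_Mapping.lookup L d)) k) = (\<Sum>d\<in>Poly_Mapping.keys L. if d = k then Poly_Mapping.lookup L k else 0)"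
    by (rule sum.cong) (auto simp: lookup_single)
  then show "Poly_Mapping.lookup L k = Poly_Mapping.lookup (\<Sum>d\<in>Poly_Mapping.keys L. Poly_Mapping.single d (Poly_Mapping.lookup L d)) k"
    by (simp add: lookup_sum in_keys_iff)
qed

lemma act_single_mult: "act (Poly_Mapping.single d c * M) f m = c * act M f (m + d)"
proof -
  have "Poly_Mapping.single d c * M = (\<Sum>e\<in>Poly_Mapping.keys M. Poly_Mapping.single (d + e) (c * Poly_Mapping.lookup M e))"
    by (subst poly_mapping_sum_single[of M]) (simp add: sum_distrib_left mult_single)
  then show ?thesis
    by (simp add: act_sum act_single act_def[of M] sum_distrib_left mult.assoc add.assoc)
qed

lemma act_mult: "act (L * M) f = act L (act M f)"
proof
  fix m
  have "L * M = (\<Sum>d\<in>Poly_Mapping.keys L. Poly_Mapping.single d (Poly_Mapping.lookup L d) * M)"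
    by (subst poly_mapping_sum_single[of L]) (simp add: sum_distrib_right)
  then show "act (L * M) f m = act L (act M f) m"
    by (simp add: act_sum act_single_mult act_def[of L])
qed

lemma act_one [simp]: "act 1 f = f"
  by (rule ext) (simp add: act_single flip: single_one)

lemma act_diff: "act (L - M) f m = act L f m - act M f m"
  using act_add[of "L - M" M f m] by simp

lemma act_linear: "act L (\<lambda>m. \<Sum>j\<in>J. c j * f j m) m = (\<Sum>j\<in>J. c j * act L (f j) m)"
  unfolding act_def sum_distrib_left by (subst sum.swap) (simp add: mult_ac)

text \<open>Applied with two maps \<Phi>: composition with \<open>hat j\<close>, and multiplication
  by a scalar to the power of the coordinate sum. Either way only a single factor has to be
  checked.\<close>

lemma act_prod_intertwine:
  assumes "\<And>i f. i \<in> A \<Longrightarrow> act (r i) (\<Phi> f) = \<Phi> (act (s i) f)"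
  shows "act (\<Prod>i\<in>A. r i) (\<Phi> f) = \<Phi> (act (\<Prod>i\<in>A. s i) f)"
  using assms by (induction A arbitrary: f rule: infinite_finite_induct) (auto simp: act_mult)

text \<open>Points are functions on all of \<open>nat\<close>, and different descriptions of a row
  continue it differently outside \<open>{1..d}\<close>. Locality makes the continuations
  interchangeable.\<close>

definition local :: "nat \<Rightarrow> ((nat \<Rightarrow> int) \<Rightarrow> 'a) \<Rightarrow> bool" where
  "local d f \<longleftrightarrow> (\<forall>m m'. (\<forall>i. 1 \<le> i \<and> i \<le> d \<longrightarrow> m i = m' i) \<longrightarrow> f m = f m')"

lemma local_act: 
  assumes "local d f" shows "local d (act L f)"
  unfolding local_def act_def
proof (intro allI impI sum.cong refl)
  fix m m' e :: "nat \<Rightarrow> int" assume "\<forall>i. 1 \<le> i \<and> i \<le> d \<longrightarrow> m i = m' i"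
  then have "f (m + e) = f (m' + e)" using assms unfolding local_def by simp
  then show "Poly_Mapping.lookup L e * f (m + e) = Poly_Mapping.lookup L e * f (m' + e)" by simp
qed

section \<open>Shifts and the operators of the theorem\<close>

definition eps :: "nat \<Rightarrow> int \<Rightarrow> nat \<Rightarrow> int" where
  "eps i c = (\<lambda>j. if j = i then c else 0)"

definition cst :: "'a::field \<Rightarrow> 'a laurent" where "cst c = Poly_Mapping.single 0 c"
definition sh :: "nat \<Rightarrow> 'a::field laurent" where "sh i = Poly_Mapping.single (eps i 1) 1"
definition shi :: "nat \<Rightarrow> 'a::field laurent" where "shi i = Poly_Mapping.single (eps i (- 1)) 1"

lemma sh_shi [simp]: "sh i * shi i = 1"
proof -
  have "eps i 1 + eps i (- 1) = 0" by (auto simp: eps_def fun_eq_iff)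
  then show ?thesis by (simp add: sh_def shi_def mult_single)
qed

lemma cst_add: "cst (a + b) = cst a + cst b" by (simp add: cst_def single_add)
lemma cst_mult: "cst (a * b) = cst a * cst b" by (simp add: cst_def mult_single)

lemma act_cst [simp]: "act (cst c) f m = c * f m" by (simp add: cst_def act_single)
lemma act_sh [simp]: "act (sh i) f m = f (m(i := m i + 1))"
  by (simp add: sh_def act_single eps_def) (rule arg_cong[of _ _ f], auto)
lemma act_shi [simp]: "act (shi i) f m = f (m(i := m i - 1))"
  by (simp add: shi_def act_single eps_def) (rule arg_cong[of _ _ f], auto)

definition opR :: "'a::field \<Rightarrow> 'a \<Rightarrow> 'a \<Rightarrow> nat \<Rightarrow> nat \<Rightarrow> 'a laurent" where
  "opR u v w p q = cst u * sh p + cst v * shi q + cst w * (sh p * shi q)"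
text \<open>\<open>opP\<close> and \<open>opQ\<close> are what remains of \<open>opR\<close> on
  functions independent of its second, respectively first, coordinate: the corresponding shift
  becomes 1.\<close>

definition opP :: "'a::field \<Rightarrow> 'a \<Rightarrow> 'a \<Rightarrow> nat \<Rightarrow> 'a laurent" where
  "opP u v w p = cst v + cst (u + w) * sh p"
definition opQ :: "'a::field \<Rightarrow> 'a \<Rightarrow> 'a \<Rightarrow> nat \<Rightarrow> 'a laurent" where
  "opQ u v w q = cst u + cst (v + w) * shi q"

lemma act_opR: "p \<noteq> q \<Longrightarrow> act (opR u v w p q) f m = u * f (m(p := m p + 1)) + v * f (m(q := m q - 1)) + w * f (m(p := m p + 1, q := m q - 1))"
  by (simp add: opR_def act_add act_mult fun_upd_twist)
lemma act_opP: "act (opP u v w p) f m = v * f m + (u + w) * f (m(p := m p + 1))"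
  by (simp add: opP_def act_add act_mult)
lemma act_opQ: "act (opQ u v w p) f m = u * f m + (v + w) * f (m(p := m p - 1))"
  by (simp add: opQ_def act_add act_mult)

definition pairs :: "nat \<Rightarrow> (nat \<times> nat) set" where
  "pairs n = {(p,q). 1 \<le> p \<and> p < q \<and> q \<le> n}"

lemma finite_pairs [simp]: "finite (pairs n)"
  by (rule finite_subset[of _ "{..n} \<times> {..n}"]) (auto simp: pairs_def)

definition opR_prod :: "'a::field \<Rightarrow> 'a \<Rightarrow> 'a \<Rightarrow> nat \<Rightarrow> 'a laurent" where
  "opR_prod u v w n = (\<Prod>(p,q)\<in>pairs n. opR u v w p q)"

lemma op_product_eq_act: "op_product n u v w f = act (opR_prod u v w n) f"
proof -
  have *: "foldr (\<lambda>(p,q) g. pair_op u v w p q g) xs f = act (\<Prod>(p,q)\<in>set xs. opR u v w p q) f"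
    if "distinct xs" "\<forall>(p,q)\<in>set xs. p \<noteq> q" for xs
    using that
    by (induction xs) (auto simp: act_mult pair_op_def act_opR split: prod.splits)
  have "set (index_pairs n) = pairs n"
    by (auto simp: index_pairs_def pairs_def)
  \<comment> \<open>This form shows distinctness, which lets the \<open>foldr\<close> become a
    product over a set.\<close>
  moreover have "index_pairs n = filter (\<lambda>(p,q). p < q) (List.product [1..<n+1] [1..<n+1])"
  proof -
    have "concat (map (\<lambda>p. concat (map (\<lambda>q. if p < q then [(p, q)] else []) ys)) xs) = 
       filter (\<lambda>(p,q). p < q) (List.product xs ys)" for xs ys :: "nat list"
    proof -
      have "concat (map (\<lambda>q. if p < q then [(p, q)] else []) ys) = filter (\<lambda>(p,q). p < q) (map (Pair p) ys)" for p
        by (induction ys) auto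
      then show ?thesis by (induction xs) auto
    qed
    then show ?thesis unfolding index_pairs_def by blast
  qed
  then have "distinct (index_pairs n)"
    by (simp add: distinct_product del: upt_Suc)
  ultimately show ?thesis
    unfolding op_product_def opR_prod_def by (subst *) (auto simp: pairs_def)
qed

subsection \<open>Alternating functions and antidifferences\<close>

text \<open>In characteristic 2 antisymmetry does not imply vanishing on the diagonal, so both are required.\<close>

definition alt :: "nat \<Rightarrow> nat \<Rightarrow> ((nat \<Rightarrow> int) \<Rightarrow> 'a::field) \<Rightarrow> bool" where
  "alt i j f \<longleftrightarrow> (\<forall>m. f (m \<circ> transpose i j) = - f m) \<and> (\<forall>m. m i = m j \<longrightarrow> f m = 0)"

text \<open>A semantic form of symmetry in i and j. It is closed under sums and products, so it can
  be shown by expanding an operator in elementary symmetric functions of the two shifts or of their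
  inverses.\<close>

definition symm :: "nat \<Rightarrow> nat \<Rightarrow> 'a::field laurent \<Rightarrow> bool" where
  "symm i j L \<longleftrightarrow> (\<forall>f. alt i j f \<longrightarrow> alt i j (act L f))"

lemma symm_mult: "symm i j L \<Longrightarrow> symm i j M \<Longrightarrow> symm i j (L * M)"
  by (simp add: symm_def act_mult)

lemma symm_add: "symm i j L \<Longrightarrow> symm i j M \<Longrightarrow> symm i j (L + M)"
  by (simp add: symm_def alt_def act_add)

lemma symm_diff: "symm i j L \<Longrightarrow> symm i j M \<Longrightarrow> symm i j (L - M)"
  by (simp add: symm_def alt_def act_diff)

lemma symm_one: "symm i j 1"
  by (simp add: symm_def)

lemma symm_cst: "symm i j (cst c)"
  by (simp add: symm_def alt_def)

lemma symm_prod: "(\<And>k. k \<in> A \<Longrightarrow> symm i j (L k)) \<Longrightarrow> symm i j (\<Prod>k\<in>A. L k)"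
  by (induction A rule: infinite_finite_induct) (auto simp: symm_one symm_mult)

lemma comp_transpose_upd:
  "(m \<circ> transpose i j)(k := c) = m(transpose i j k := c) \<circ> transpose i j"
  by (auto simp: fun_eq_iff transpose_def)

lemma symm_sh: "k \<noteq> i \<Longrightarrow> k \<noteq> j \<Longrightarrow> symm i j (sh k)"
  by (simp add: symm_def alt_def comp_transpose_upd)

lemma symm_shi: "k \<noteq> i \<Longrightarrow> k \<noteq> j \<Longrightarrow> symm i j (shi k)"
  by (simp add: symm_def alt_def comp_transpose_upd)

text \<open>A single shift leaves the diagonal \<open>m i = m j\<close>, so vanishing there does not
  help; but the two terms of \<open>sh i + sh j\<close> land on points exchanged by the
  transposition, and antisymmetry cancels them.\<close>

lemma diag_upd:
  assumes "(m::nat \<Rightarrow> int) i = m j" shows "m(i := c) = m(j := c) \<circ> transpose i j"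
  using assms by (auto simp: fun_eq_iff transpose_def)

lemma symm_sh_add: "symm i j (sh i + sh j)"
  unfolding symm_def alt_def act_add act_sh
proof (intro allI impI conjI, goal_cases)
  case (1 f m)
  then show ?case by (simp add: comp_transpose_upd)
next
  case (2 f m)
  have "m(i := m j + 1) = m(j := m j + 1) \<circ> transpose i j" by (rule diag_upd) (rule 2)
  with 2 show ?case by simp
qed

lemma symm_shi_add: "symm i j (shi i + shi j)"
  unfolding symm_def alt_def act_add act_shi
proof (intro allI impI conjI, goal_cases)
  case (1 f m)
  then show ?case by (simp add: comp_transpose_upd)
next
  case (2 f m)
  have "m(i := m j - 1) = m(j := m j - 1) \<circ> transpose i j" by (rule diag_upd) (rule 2)
  with 2 show ?case by simp
qed

lemma symm_sh_mult: "i \<noteq> j \<Longrightarrow> symm i j (sh i * sh j)"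
  by (auto simp add: symm_def alt_def act_mult comp_transpose_upd fun_upd_twist)

lemma symm_shi_mult: "i \<noteq> j \<Longrightarrow> symm i j (shi i * shi j)"
  by (auto simp add: symm_def alt_def act_mult comp_transpose_upd fun_upd_twist)

lemma symm_opR_other:
  "p \<noteq> i \<Longrightarrow> p \<noteq> j \<Longrightarrow> q \<noteq> i \<Longrightarrow> q \<noteq> j \<Longrightarrow> symm i j (opR u v w p q)"
  unfolding opR_def by (intro symm_add symm_mult symm_cst symm_sh symm_shi)

text \<open>The factors are \<open>a + b * shi i\<close> and \<open>a + b * shi j\<close> with the
  same a and b, free of i and j, so only the sum and the product of the inverse shifts
  occur.\<close>

lemma symm_opR_right:
  assumes "p \<noteq> i" "p \<noteq> j" "i \<noteq> j"
  shows "symm i j (opR u v w p i * opR u v w p j)"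
proof -
  let ?a = "cst u * sh p" and ?b = "cst v + cst w * sh p"
  have "opR u v w p i * opR u v w p j = ?a * ?a + ?a * ?b * (shi i + shi j) + ?b * ?b * (shi i * shi j)"
    by (simp add: opR_def algebra_simps)
  then show ?thesis
    using assms by (simp only:) (intro symm_shi_mult symm_sh_mult symm_shi_add symm_sh_add symm_add symm_mult symm_cst symm_sh symm_shi; simp)
qed

lemma symm_opR_left:
  assumes "q \<noteq> i" "q \<noteq> j" "i \<noteq> j"
  shows "symm i j (opR u v w i q * opR u v w j q)"
proof -
  let ?a = "cst v * shi q" and ?b = "cst u + cst w * shi q"
  have "opR u v w i q * opR u v w j q = ?a * ?a + ?a * ?b * (sh i + sh j) + ?b * ?b * (sh i * sh j)"
    by (simp add: opR_def algebra_simps)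
  then show ?thesis
    using assms by (simp only:) (intro symm_shi_mult symm_sh_mult symm_shi_add symm_sh_add symm_add symm_mult symm_cst symm_sh symm_shi; simp)
qed

text \<open>Here \<open>x\<close>, \<open>y\<close> stand for the two shifts and \<open>x'\<close>,
  \<open>y'\<close> for their inverses. A single factor need not be symmetric; multiplied by its
  opposite, all mixed terms collapse to constants or to symmetric couples.\<close>

lemma opR_swap_identity:
  fixes u v w x x' y y' :: "'b::comm_ring_1"
  assumes "x * x' = 1" "y * y' = 1"
  shows "(u * y + v * x' + w * (y * x')) * (u * x + v * y' + w * (x * y')) =
    u * u * (x * y) + v * v * (x' * y') + w * w + u * v + u * v + u * w * (x + y) + v * w * (x' + y')"
proof -
  have *: "x * (x' * c) = c" "y * (y' * c) = c" for c
    using assms by (simp_all flip: mult.assoc)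
  show ?thesis
    by (simp add: algebra_simps assms *)
qed

lemma symm_opR_swap:
  assumes "i \<noteq> j"
  shows "symm i j (opR u v w j i * opR u v w i j)"
proof -
  have "opR u v w j i * opR u v w i j =
      cst u * cst u * (sh i * sh j) + cst v * cst v * (shi i * shi j) + cst w * cst w
      + cst u * cst v + cst u * cst v + cst u * cst w * (sh i + sh j) + cst v * cst w * (shi i + shi j)"
    unfolding opR_def by (rule opR_swap_identity) simp_all
  then show ?thesis
    using assms by (simp only:) (intro symm_shi_mult symm_sh_mult symm_shi_add symm_sh_add symm_add symm_mult symm_cst symm_sh symm_shi; simp)
qed

text \<open>As t and t+1 are adjacent, every other index lies on the same side of both. Hence the
  factors meeting them come in couples (p,t), (p,t+1) or (t,q), (t+1,q). Only (t,t+1) lacks a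
  partner, and the additional factor supplies it.\<close>

lemma symm_opR_prod:
  assumes t: "1 \<le> t" "t < d"
  shows "symm t (Suc t) (opR u v w (Suc t) t * opR_prod u v w d)"
proof -
  let ?r = "\<lambda>(p,q). opR u v w p q"
  define B2 where "B2 = {1..<t} \<times> {t, Suc t}"
  \<comment> \<open>Coordinates are swapped here so that \<open>prod.cartesian_product\<close>
    collects the two factors with the same q.\<close>
  define B3 where "B3 = {Suc t<..d} \<times> {t, Suc t}"
  define B4 where "B4 = {(p,q)\<in>pairs d. p \<notin> {t, Suc t} \<and> q \<notin> {t, Suc t}}"
  have eq: "pairs d = insert (t, Suc t) (B2 \<union> (prod.swap ` B3 \<union> B4))"
    using t by (auto simp: pairs_def B2_def B3_def B4_def image_iff)
  have fin: "finite B2" "finite (prod.swap ` B3)" "finite B4"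
    by (auto simp: B2_def B3_def B4_def intro: finite_subset[OF _ finite_pairs])
  have "opR_prod u v w d = ?r (t, Suc t) * prod ?r (B2 \<union> (prod.swap ` B3 \<union> B4))"
    unfolding opR_prod_def eq
    by (rule prod.insert) (use fin in \<open>auto simp: B2_def B3_def B4_def\<close>)
  also have "prod ?r (B2 \<union> (prod.swap ` B3 \<union> B4)) = prod ?r B2 * prod ?r (prod.swap ` B3 \<union> B4)"
    by (rule prod.union_disjoint) (use fin in \<open>auto simp: B2_def B3_def B4_def\<close>)
  also have "prod ?r (prod.swap ` B3 \<union> B4) = prod ?r (prod.swap ` B3) * prod ?r B4"
    by (rule prod.union_disjoint) (use fin in \<open>auto simp: B2_def B3_def B4_def\<close>)
  also have "prod ?r B2 = (\<Prod>p\<in>{1..<t}. opR u v w p t * opR u v w p (Suc t))"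
    unfolding B2_def by (subst prod.cartesian_product[symmetric]) simp
  also have "prod ?r (prod.swap ` B3) = (\<Prod>(q,p)\<in>B3. opR u v w p q)"
    by (subst prod.reindex) (auto intro!: prod.cong)
  also have "\<dots> = (\<Prod>q\<in>{Suc t<..d}. opR u v w t q * opR u v w (Suc t) q)"
    unfolding B3_def by (subst prod.cartesian_product[symmetric]) simp
  finally have "opR u v w (Suc t) t * opR_prod u v w d = (opR u v w (Suc t) t * opR u v w t (Suc t)) *
      ((\<Prod>p\<in>{1..<t}. opR u v w p t * opR u v w p (Suc t)) *
       ((\<Prod>q\<in>{Suc t<..d}. opR u v w t q * opR u v w (Suc t) q) * prod ?r B4))"
    by (simp add: mult.assoc)
  moreover have "symm t (Suc t) (prod ?r B4)"
    by (rule symm_prod) (auto simp: B4_def intro!: symm_opR_other)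
  ultimately show ?thesis
    by (auto intro!: symm_mult[of _ _ "opR u v w (Suc t) t * opR u v w t (Suc t)"]
        symm_mult[of _ _ "prod _ _"] symm_prod symm_opR_swap symm_opR_right symm_opR_left)
qed

text \<open>The sum of f over [0,y), continued to negative y so that its difference is f everywhere.\<close>

definition isum :: "(int \<Rightarrow> 'a::ab_group_add) \<Rightarrow> int \<Rightarrow> 'a" where
  "isum f y = (if 0 \<le> y then \<Sum>z\<in>{0..<y}. f z else - (\<Sum>z\<in>{y..<0}. f z))"

lemma isum_succ: "isum f (y + 1) = isum f y + f y"
proof (cases "0 \<le> y")
  case True
  then have "{0..<y+1} = insert y {0..<y}" by auto
  with True show ?thesis by (simp add: isum_def)
next
  case False
  then have "{y..<0} = insert y {y+1..<0}" by auto
  with False show ?thesis by (cases "y = -1") (simp_all add: isum_def)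
qed

lemma isum_minus: "isum (\<lambda>z. - f z) y = - isum f y"
  by (simp add: isum_def sum_negf)

lemma isum_swap: "isum (\<lambda>z. isum (g z) b) a = isum (\<lambda>z'. isum (\<lambda>z. g z z') a) b"
  unfolding isum_def
  by (auto simp: sum_negf intro: sum.swap)

text \<open>Antisymmetry of the double sum \<open>G\<close> gives only
  \<open>G a a = - G a a\<close>, which is too weak in characteristic 2. Instead the diagonal is
  followed from 0: \<open>G (a + 1) (a + 1) = - G a a\<close>, because the new corner
  \<open>g a a\<close> is zero.\<close>

lemma isum_isum_diag:
  assumes anti: "\<And>z z'. g z z' = - g z' z" and diag: "\<And>z. g z z = 0"
  shows "isum (\<lambda>z. isum (g z) a) a = (0::'a::ab_group_add)"
proof -
  define G where "G a b = isum (\<lambda>z. isum (g z) b) a" for a b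
  have G1: "G (a + 1) b = G a b + isum (g a) b" for a b
    by (simp add: G_def isum_succ)
  have "G a b = isum (\<lambda>z'. isum (\<lambda>z. g z z') a) b" for a b
    unfolding G_def by (rule isum_swap)
  also have "isum (\<lambda>z'. isum (\<lambda>z. g z z') a) b = - G b a" for a b
    unfolding G_def by (subst anti) (simp add: isum_minus)
  finally have Ganti: "G a b = - G b a" for a b .
  have step: "G (a + 1) (a + 1) = - G a a" for a
  proof -
    have "G (a + 1) (a + 1) = G a (a + 1) + (isum (g a) a + g a a)"
      by (simp add: G1 isum_succ)
    also have "G a (a + 1) = - (G a a + isum (g a) a)"
      by (subst Ganti) (simp add: G1)
    finally show ?thesis by (simp add: diag)
  qed
  have "G a a = 0"
  proof (induction a rule: int_induct[of _ 0])
    case base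
    then show ?case by (simp add: G_def isum_def)
  next
    case (step1 i)
    then show ?case by (simp add: step)
  next
    case (step2 i)
    then show ?case using step[of "i - 1"] by simp
  qed
  then show ?thesis by (simp add: G_def)
qed

text \<open>All coordinates share the base point 0; constants of summation depending on the
  coordinate could destroy alternation.\<close>

definition anti :: "nat \<Rightarrow> ((nat \<Rightarrow> int) \<Rightarrow> 'a::field) \<Rightarrow> (nat \<Rightarrow> int) \<Rightarrow> 'a" where
  "anti i f m = isum (\<lambda>z. f (m(i := z))) (m i)"

lemma act_diff_anti: "act (sh i - 1) (anti i f) = f"
  by (rule ext) (simp add: act_diff anti_def isum_succ)

lemma alt_anti:
  assumes "k \<noteq> i" "k \<noteq> j" "alt i j f" shows "alt i j (anti k f)"
  using assms by (simp add: alt_def anti_def comp_transpose_upd isum_minus) (simp add: isum_def)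

text \<open>One antidifference singles out a coordinate. The second restores the balance, by
  exchanging the two sums and, on the diagonal, by \<open>isum_isum_diag\<close>.\<close>

lemma alt_anti_anti:
  assumes "i \<noteq> j" "alt i j f" shows "alt i j (anti i (anti j f))"
proof -
  let ?g = "\<lambda>(m :: nat \<Rightarrow> int) z z'. f (m(i := z, j := z'))"
  have eq: "anti i (anti j f) m = isum (\<lambda>z. isum (?g m z) (m j)) (m i)" for m
    using assms by (simp add: anti_def)
  have tr: "(m \<circ> transpose i j)(i := z, j := z') = m(i := z', j := z) \<circ> transpose i j" for m :: "nat \<Rightarrow> int" and z z'
    using assms by (auto simp: fun_eq_iff transpose_def)
  have sw: "m(i := z, j := z') = m(i := z', j := z) \<circ> transpose i j" for m :: "nat \<Rightarrow> int" and z z'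
    using assms by (auto simp: fun_eq_iff transpose_def)
  have f1: "f (m \<circ> transpose i j) = - f m" and f2: "m i = m j \<Longrightarrow> f m = 0" for m
    using assms by (auto simp: alt_def)
  show ?thesis
    unfolding alt_def
  proof (intro conjI allI impI)
    fix m :: "nat \<Rightarrow> int"
    have "anti i (anti j f) (m \<circ> transpose i j) = isum (\<lambda>z. isum (\<lambda>z'. - ?g m z' z) (m i)) (m j)"
      unfolding eq tr f1 by simp
    also have "\<dots> = - isum (\<lambda>z. isum (\<lambda>z'. ?g m z' z) (m i)) (m j)" by (simp add: isum_minus)
    also have "\<dots> = - isum (\<lambda>z. isum (?g m z) (m j)) (m i)" by (subst isum_swap) simp
    finally show "anti i (anti j f) (m \<circ> transpose i j) = - anti i (anti j f) m" by (simp add: eq)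
  next
    fix m :: "nat \<Rightarrow> int" assume m: "m i = m j"
    have "isum (\<lambda>z. isum (?g m z) (m j)) (m j) = 0"
    proof (rule isum_isum_diag)
      fix z z' show "?g m z z' = - ?g m z' z" by (subst sw) (rule f1)
      show "?g m z z = 0" by (rule f2) (use assms in auto)
    qed
    then show "anti i (anti j f) m = 0" by (simp add: eq m)
  qed
qed

primrec antis :: "nat \<Rightarrow> ((nat \<Rightarrow> int) \<Rightarrow> 'a::field) \<Rightarrow> (nat \<Rightarrow> int) \<Rightarrow> 'a" where
  "antis 0 f = f"
| "antis (Suc d) f = antis d (anti (Suc d) f)"

lemma act_diff_antis: "act (\<Prod>i\<in>{1..d}. sh i - 1) (antis d f) = f"
proof (induction d arbitrary: f)
  case (Suc d)
  have "(\<Prod>i\<in>{1..Suc d}. sh i - 1) = (sh (Suc d) - 1) * (\<Prod>i\<in>{1..d}. sh i - 1 :: 'a laurent)"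
    by (simp add: prod.nat_ivl_Suc')
  then show ?case using Suc by (simp only: act_mult act_diff_anti antis.simps)
qed simp

lemma alt_antis_high: "d < i \<Longrightarrow> d < j \<Longrightarrow> alt i j f \<Longrightarrow> alt i j (antis d f)"
proof (induction d arbitrary: f)
  case (Suc d)
  then show ?case by (auto intro!: Suc.IH alt_anti)
qed simp

lemma alt_antis:
  assumes "1 \<le> t" "t < d" "alt t (Suc t) f" shows "alt t (Suc t) (antis d f)"
  using assms
proof (induction d arbitrary: f)
  case (Suc d)
  show ?case
  proof (cases "t = d")
    \<comment> \<open>Coordinates t and t+1 are summed one right after the other; the remaining
      antidifferences concern smaller indices only.\<close>
    case True
    then obtain e where "d = Suc e" using Suc.prems by (cases d) auto
    then show ?thesis using Suc.prems True by (auto intro!: alt_antis_high alt_anti_anti)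
  next
    case False
    then show ?thesis using Suc by (auto intro!: Suc.IH alt_anti)
  qed
qed simp

lemma local_anti: assumes "1 \<le> k" "k \<le> d" "local d f" shows "local d (anti k f)"
  unfolding local_def anti_def
proof (intro allI impI)
  fix m m' :: "nat \<Rightarrow> int" assume *: "\<forall>i. 1 \<le> i \<and> i \<le> d \<longrightarrow> m i = m' i"
  then have "f (m(k := z)) = f (m'(k := z))" for z
    using assms unfolding local_def by simp
  then show "isum (\<lambda>z. f (m(k := z))) (m k) = isum (\<lambda>z. f (m'(k := z))) (m' k)"
    using * assms by simp
qed

lemma local_antis: "d \<le> e \<Longrightarrow> local e f \<Longrightarrow> local e (antis d f)"
proof (induction d arbitrary: f)
  case (Suc d)
  then show ?case by (auto intro!: Suc.IH local_anti)
qed simp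

subsection \<open>Weighted sums over interlacing rows\<close>

text \<open>The right bound belongs to position i+1 and is shifted by one more than the entry, so a
  right-leaning entry sits at \<open>b - 1\<close> and a left-leaning one at
  \<open>a\<close>.\<close>

definition wt :: "'a::field \<Rightarrow> 'a \<Rightarrow> 'a \<Rightarrow> int \<Rightarrow> int \<Rightarrow> int \<Rightarrow> 'a" where
  "wt u v w a b z = (if z = a then v else if z = b - 1 then u else u + v + w)"

text \<open>The gap keeps the end points \<open>a\<close> and \<open>b - 1\<close> apart. The
  interior telescopes with weight \<open>u + v + w\<close>, and together with the end terms the
  boundary values regroup into \<open>opQ\<close> at \<open>b\<close> and \<open>opP\<close> at
  \<open>a\<close>.\<close>

lemma sum_wt_diff:
  assumes "a + 2 \<le> b"
  shows "(\<Sum>z\<in>{a..<b}. wt u v w a b z * (h (z + 1) - h z))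
    = u * h b + (v + w) * h (b - 1) - (v * h a + (u + w) * h (a + 1))"
proof -
  have tel: "(\<Sum>z\<in>{a'..<b'}. h (z + 1) - h z) = h b' - h a'" if "a' \<le> b'" for a' b'
    using that
  proof (induction b' rule: int_ge_induct)
    case (step i)
    then have "{a'..<i + 1} = insert i {a'..<i}" by auto
    then show ?case using step by simp
  qed simp
  have "{a..<b} = insert a (insert (b - 1) {a+1..<b-1})" using assms by auto
  then have "(\<Sum>z\<in>{a..<b}. wt u v w a b z * (h (z + 1) - h z)) =
     v * (h (a + 1) - h a) + (u * (h b - h (b - 1)) + (\<Sum>z\<in>{a+1..<b-1}. wt u v w a b z * (h (z + 1) - h z)))"
    using assms by (simp add: wt_def)
  also have "(\<Sum>z\<in>{a+1..<b-1}. wt u v w a b z * (h (z + 1) - h z)) =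
      (\<Sum>z\<in>{a+1..<b-1}. (u + v + w) * (h (z + 1) - h z))"
    by (rule sum.cong) (auto simp: wt_def)
  also have "\<dots> = (u + v + w) * (h (b - 1) - h (a + 1))"
    using assms by (subst sum_distrib_left[symmetric], subst tel) auto
  finally show ?thesis by (simp add: algebra_simps)
qed

lemma sum_wt_act:
  assumes "a + 2 \<le> b"
  shows "(\<Sum>z\<in>{a..<b}. wt u v w a b z * act (M * (sh i - 1)) \<beta> (m(i := z)))
    = act (M * opQ u v w i) \<beta> (m(i := b)) - act (M * opP u v w i) \<beta> (m(i := a))"
proof -
  define h where "h z = act M \<beta> (m(i := z))" for z
  have "act (M * (sh i - 1)) \<beta> (m(i := z)) = h (z + 1) - h z" for z
    by (subst mult.commute) (simp add: act_mult act_diff h_def)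
  moreover have "act (M * opQ u v w i) \<beta> (m(i := b)) = u * h b + (v + w) * h (b - 1)"
    by (subst mult.commute) (simp add: act_mult act_opQ h_def)
  moreover have "act (M * opP u v w i) \<beta> (m(i := a)) = v * h a + (u + w) * h (a + 1)"
    by (subst mult.commute) (simp add: act_mult act_opP h_def)
  ultimately show ?thesis using sum_wt_diff[OF assms, of u v w h] by simp
qed

text \<open>Rows in the shifted coordinates, only the first t entries being constrained: strictness of the
  original row excludes just that two neighbours sit at the two sides of a common bound.\<close>

definition rows :: "nat \<Rightarrow> (nat \<Rightarrow> int) \<Rightarrow> (nat \<Rightarrow> int) \<Rightarrow> (nat \<Rightarrow> int) set" where
  "rows t x y = {z. (\<forall>i\<in>{1..t}. x i \<le> z i \<and> z i < x (Suc i)) \<and>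
     (\<forall>i\<in>{1..<t}. \<not> (z i = x (Suc i) - 1 \<and> z (Suc i) = x (Suc i))) \<and>
     (\<forall>i. i \<notin> {1..t} \<longrightarrow> z i = y i)}"

lemma rows_0 [simp]: "rows 0 x y = {y}"
  by (auto simp: rows_def)

lemma rows_fiber:
  assumes "x (Suc t) \<le> z" "z < x (Suc (Suc t))"
  shows "{r \<in> rows (Suc t) x y. r (Suc t) = z} = rows t x (y(Suc t := z)) -
    {r \<in> rows t x (y(Suc t := z)). 1 \<le> t \<and> z = x (Suc t) \<and> r t = x (Suc t) - 1}"
  using assms unfolding rows_def by (auto simp: less_Suc_eq_le le_Suc_eq dest: le_neq_implies_less)

text \<open>By the gap, \<open>x (Suc t) - 1\<close> is not the left end \<open>x t\<close> of the
  same interval, so fixing entry t there imposes nothing on entry t-1.\<close>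

lemma rows_bad:
  assumes "1 \<le> t" "\<forall>i\<in>{1..t}. x i + 2 \<le> x (Suc i)"
  shows "{r \<in> rows t x y. r t = x (Suc t) - 1} = rows (t - 1) x (y(t := x (Suc t) - 1))"
proof -
  obtain s where t: "t = Suc s" using assms by (cases t) auto
  have "x t + 2 \<le> x (Suc t)" using assms by auto
  then show ?thesis unfolding t rows_def 
    by (auto simp: less_Suc_eq_le le_Suc_eq dest: le_neq_implies_less)
qed

lemma finite_rows [simp]: "finite (rows t x y)"
proof (induction t arbitrary: y)
  case (Suc t)
  have "rows (Suc t) x y \<subseteq> (\<Union>z\<in>{x (Suc t)..<x (Suc (Suc t))}. rows t x (y(Suc t := z)))"
  proof
    fix r assume r: "r \<in> rows (Suc t) x y"
    then have "r \<in> rows t x (y(Suc t := r (Suc t)))" "r (Suc t) \<in> {x (Suc t)..<x (Suc (Suc t))}"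
      by (auto simp: rows_def)
    then show "r \<in> (\<Union>z\<in>{x (Suc t)..<x (Suc (Suc t))}. rows t x (y(Suc t := z)))" by blast
  qed
  then show ?case by (rule finite_subset) (simp add: Suc)
qed simp

section \<open>Summing out one coordinate at a time\<close>

definition row_sum :: "'a::field \<Rightarrow> 'a \<Rightarrow> 'a \<Rightarrow> nat \<Rightarrow> (nat \<Rightarrow> int) \<Rightarrow> ((nat \<Rightarrow> int) \<Rightarrow> 'a) \<Rightarrow> (nat \<Rightarrow> int) \<Rightarrow> 'a" where
  "row_sum u v w t x b y = (\<Sum>z\<in>rows t x y. (\<Prod>i\<in>{1..t}. wt u v w (x i) (x (Suc i)) (z i)) * b z)"

text \<open>The last coordinate is summed freely and the forbidden configuration is subtracted.
  There entry t is at its right end (weight u) and entry t+1 at its left end (weight v), leaving a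
  row sum over t-1 coordinates.\<close>

lemma row_sum_Suc:
  assumes gap: "\<forall>i\<in>{1..Suc t}. x i + 2 \<le> x (Suc i)"
  shows "row_sum u v w (Suc t) x b y =
    (\<Sum>z\<in>{x (Suc t)..<x (Suc (Suc t))}. wt u v w (x (Suc t)) (x (Suc (Suc t))) z * row_sum u v w t x b (y(Suc t := z)))
    - (if t = 0 then 0 else u * v * row_sum u v w (t - 1) x b (y(Suc t := x (Suc t), t := x (Suc t) - 1)))"
proof -
  define W where "W s z = (\<Prod>i\<in>{1..s}. wt u v w (x i) (x (Suc i)) (z i))" for s z
  let ?I = "{x (Suc t)..<x (Suc (Suc t))}"
  let ?a = "x (Suc t)" and ?b = "x (Suc (Suc t))"
  let ?F = "\<lambda>r. W (Suc t) r * b r"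
  define B where "B z = {r \<in> rows t x (y(Suc t := z)). 1 \<le> t \<and> z = ?a \<and> r t = ?a - 1}" for z
  have WS: "W (Suc t) r = wt u v w ?a ?b z * W t r" if "r \<in> rows t x (y(Suc t := z))" for r z
    using that by (simp add: W_def rows_def)
  have "row_sum u v w (Suc t) x b y = (\<Sum>z\<in>?I. \<Sum>r | r \<in> rows (Suc t) x y \<and> r (Suc t) = z. ?F r)"
    unfolding row_sum_def W_def[symmetric]
    by (rule sum.group[symmetric]) (simp, simp, auto simp: rows_def)
  also have "\<dots> = (\<Sum>z\<in>?I. sum ?F (rows t x (y(Suc t := z))) - sum ?F (B z))"
  proof (rule sum.cong[OF refl])
    fix z assume "z \<in> ?I"
    then have "{r \<in> rows (Suc t) x y. r (Suc t) = z} = rows t x (y(Suc t := z)) - B z"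
      unfolding B_def by (intro rows_fiber) auto
    then show "(\<Sum>r | r \<in> rows (Suc t) x y \<and> r (Suc t) = z. ?F r) = sum ?F (rows t x (y(Suc t := z))) - sum ?F (B z)"
      by (simp add: sum_diff B_def)
  qed
  also have "\<dots> = (\<Sum>z\<in>?I. sum ?F (rows t x (y(Suc t := z)))) - (\<Sum>z\<in>?I. sum ?F (B z))"
    by (simp add: sum_subtractf)
  also have "(\<Sum>z\<in>?I. sum ?F (rows t x (y(Suc t := z)))) =
      (\<Sum>z\<in>?I. wt u v w ?a ?b z * row_sum u v w t x b (y(Suc t := z)))"
    unfolding row_sum_def W_def[symmetric] sum_distrib_left
    by (intro sum.cong refl) (simp add: WS mult.assoc)
  also have "(\<Sum>z\<in>?I. sum ?F (B z)) = sum ?F (B ?a)"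
  proof -
    have "(\<Sum>z\<in>?I. sum ?F (B z)) = (\<Sum>z\<in>{?a}. sum ?F (B z))"
      using bspec[OF gap, of "Suc t"] by (intro sum.mono_neutral_right) (auto simp: B_def)
    then show ?thesis by simp
  qed
  also have "sum ?F (B ?a) = (if t = 0 then 0 else u * v * row_sum u v w (t - 1) x b (y(Suc t := ?a, t := ?a - 1)))"
  proof (cases "t = 0")
    case False
    then have t: "1 \<le> t" by simp
    then obtain s where s: "t = Suc s" by (cases t) auto
    have B: "B ?a = rows (t - 1) x (y(Suc t := ?a, t := ?a - 1))"
      unfolding B_def using rows_bad[OF t, of x "y(Suc t := ?a)"] gap t by auto
    have "x t + 2 \<le> ?a" using gap t by auto
    then have "W (Suc t) r = u * v * W (t - 1) r" if "r \<in> B ?a" for r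
      using that unfolding B by (simp add: W_def rows_def s wt_def)
    then show ?thesis using False
      unfolding row_sum_def W_def[symmetric] sum_distrib_left B
      by (auto intro!: sum.cong simp: mult.assoc)
  qed (simp add: B_def)
  finally show ?thesis .
qed

text \<open>The evaluation point of the j-th term after t summations: the first t coordinates have
  become bounds, with \<open>x j\<close> left out, and the others still wait.\<close>

definition pt :: "(nat \<Rightarrow> int) \<Rightarrow> nat \<Rightarrow> nat \<Rightarrow> (nat \<Rightarrow> int) \<Rightarrow> nat \<Rightarrow> int" where
  "pt x j t y = (\<lambda>i. if 1 \<le> i \<and> i \<le> t then (if i < j then x i else x (Suc i)) else y i)"

text \<open>The factor \<open>(sh i - 1) * shi i\<close> is \<open>1 - shi i\<close>, split to match
  \<open>row_sum_Suc\<close>: the differences come from the summand, \<open>shi i\<close> from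
  evaluating coordinate i one step to the left.\<close>

lemma opQ_opP_identity:
  "opQ u v w i * opP u v w j + cst (u * v) * ((sh i - 1) * shi i * (sh j - 1)) = cst (u + v + w) * opR u v w j i"
proof -
  have *: "c * (sh i * shi i) = c" "sh i * (c * shi i) = c" "sh i * (shi i * c) = c" for c :: "'a laurent"
    by (simp_all add: mult.left_commute[of "sh i"]) (metis mult.left_commute mult.right_neutral sh_shi)
  show ?thesis
    by (simp add: opQ_def opP_def opR_def algebra_simps cst_add cst_mult *)
qed

text \<open>Coordinates beyond t keep the difference operators that produce \<open>b\<close> from
  \<beta>; each summation trades one of them for Q or -P. The recursion refers back two steps, hence
  the strong induction.\<close>

lemma row_sum_eq:
  assumes gap: "\<forall>i\<in>{1..d}. x i + 2 \<le> x (Suc i)"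
    and alt: "\<And>t. 1 \<le> t \<Longrightarrow> t < d \<Longrightarrow> alt t (Suc t) (act (opR u v w (Suc t) t) \<beta>)"
    and b: "b = act (\<Prod>i\<in>{1..d}. sh i - 1) \<beta>"
    and "t \<le> d"
  shows "row_sum u v w t x b y = (\<Sum>j\<in>{1..Suc t}. (-1) ^ (j - 1) *
     act ((\<Prod>i\<in>{1..<j}. opP u v w i) * (\<Prod>i\<in>{j..t}. opQ u v w i) * (\<Prod>i\<in>{Suc t..d}. sh i - 1)) \<beta> (pt x j t y))"
  using \<open>t \<le> d\<close>
proof (induction t arbitrary: y rule: less_induct)
  case (less t)
  define K where "K j t = (\<Prod>i\<in>{1..<j}. opP u v w i) * (\<Prod>i\<in>{j..t}. opQ u v w i) * (\<Prod>i\<in>{Suc t..d}. sh i - 1)" for j t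
  show ?case
  proof (cases t)
    case 0
    have "pt x j 0 y = y" for j by (auto simp: pt_def fun_eq_iff)
    then show ?thesis by (simp add: 0 row_sum_def b)
  next
    case (Suc s)
    let ?a = "x (Suc s)" and ?b = "x (Suc (Suc s))"
    define M where "M j = (\<Prod>i\<in>{1..<j}. opP u v w i) * (\<Prod>i\<in>{j..s}. opQ u v w i) * (\<Prod>i\<in>{Suc (Suc s)..d}. sh i - 1)" for j
    define p where "p j = (pt x j s y)(Suc s := ?a)" for j
    let ?s = "\<lambda>j::nat. (-1) ^ (j - 1) :: 'a"
    have gap1: "?a + 2 \<le> ?b" using gap less.prems Suc by auto
    have KM: "K j s = M j * (sh (Suc s) - 1)" for j
      using less.prems Suc by (simp add: K_def M_def prod.atLeast_Suc_atMost[of "Suc s"] mult_ac)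
    have MQ: "M j * opQ u v w (Suc s) = K j (Suc s)" if "j \<le> Suc s" for j
      using that by (simp add: K_def M_def mult_ac)
    have MP: "M (Suc s) * opP u v w (Suc s) = K (Suc (Suc s)) (Suc s)"
      by (simp add: K_def M_def mult_ac)
    have IH: "row_sum u v w r x b y = (\<Sum>j\<in>{1..Suc r}. ?s j * act (K j r) \<beta> (pt x j r y))" if "r < t" for r y
      unfolding K_def by (rule less.IH) (use that less.prems in auto)
    have upd: "pt x j s (y(Suc s := z)) = (pt x j s y)(Suc s := z)" for j z
      by (auto simp: pt_def fun_eq_iff)
    define S where "S = (\<Sum>z\<in>{?a..<?b}. wt u v w ?a ?b z * row_sum u v w s x b (y(Suc s := z)))"
    have "S =
       (\<Sum>z\<in>{?a..<?b}. \<Sum>j\<in>{1..Suc s}. ?s j * (wt u v w ?a ?b z * act (M j * (sh (Suc s) - 1)) \<beta> ((pt x j s y)(Suc s := z))))"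
      unfolding S_def by (subst IH) (simp_all add: Suc KM upd sum_distrib_left mult_ac del: sum.cl_ivl_Suc)
    also have "\<dots> = (\<Sum>j\<in>{1..Suc s}. ?s j * (act (M j * opQ u v w (Suc s)) \<beta> ((pt x j s y)(Suc s := ?b)) - act (M j * opP u v w (Suc s)) \<beta> (p j)))"
      unfolding p_def sum_wt_act[OF gap1, symmetric] sum_distrib_left by (rule sum.swap)
    also have "\<dots> = (\<Sum>j\<in>{1..Suc s}. ?s j * act (K j (Suc s)) \<beta> (pt x j (Suc s) y)) - (\<Sum>j\<in>{1..Suc s}. ?s j * act (M j * opP u v w (Suc s)) \<beta> (p j))"
    proof -
      have "(pt x j s y)(Suc s := ?b) = pt x j (Suc s) y" if "j \<le> Suc s" for j
        using that by (auto simp: pt_def fun_eq_iff)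
      then show ?thesis
        by (simp add: MQ right_diff_distrib sum_subtractf del: sum.cl_ivl_Suc)
    qed
    \<comment> \<open>For j = s+1 no Q has occurred yet, so the left end point continues the pattern
      and yields the new term with index s+2.\<close>
    also have "(\<Sum>j\<in>{1..Suc s}. ?s j * act (M j * opP u v w (Suc s)) \<beta> (p j)) =
       (\<Sum>j\<in>{1..s}. ?s j * act (M j * opP u v w (Suc s)) \<beta> (p j)) - ?s (Suc (Suc s)) * act (K (Suc (Suc s)) (Suc s)) \<beta> (pt x (Suc (Suc s)) (Suc s) y)"
    proof -
      have "p (Suc s) = pt x (Suc (Suc s)) (Suc s) y"
        by (auto simp: pt_def p_def fun_eq_iff)
      then show ?thesis by (simp add: MP)
    qed
    finally have "S =
       (\<Sum>j\<in>{1..Suc (Suc s)}. ?s j * act (K j (Suc s)) \<beta> (pt x j (Suc s) y)) - (\<Sum>j\<in>{1..s}. ?s j * act (M j * opP u v w (Suc s)) \<beta> (p j))"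
      by (simp add: algebra_simps)
    note 1 = this[unfolded S_def]
    \<comment> \<open>For \<open>j \<le> s\<close> the point \<open>p j\<close> has
      \<open>x (Suc s)\<close> in both coordinates s and s+1. Combined with the correction, the
      operator becomes \<open>opR\<close> times one free of these coordinates; applied to \<beta> it
      gives an alternating function, which vanishes at \<open>p j\<close>.\<close>
    have 2: "(if s = 0 then 0 else u * v * row_sum u v w (s - 1) x b (y(Suc s := ?a, s := ?a - 1)))
       = - (\<Sum>j\<in>{1..s}. ?s j * act (M j * opP u v w (Suc s)) \<beta> (p j))"
    proof (cases s)
      case (Suc r)
      define N where "N j = (\<Prod>i\<in>{1..<j}. opP u v w i) * (\<Prod>i\<in>{j..r}. opQ u v w i) * (\<Prod>i\<in>{Suc (Suc s)..d}. sh i - 1)" for j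
      have "row_sum u v w r x b (y(Suc s := ?a, s := ?a - 1)) =
         (\<Sum>j\<in>{1..s}. ?s j * act (K j r) \<beta> (pt x j r (y(Suc s := ?a, s := ?a - 1))))"
        using IH[of r] \<open>t = Suc s\<close> Suc by simp
      moreover have "u * v * act (K j r) \<beta> (pt x j r (y(Suc s := ?a, s := ?a - 1))) = - act (M j * opP u v w (Suc s)) \<beta> (p j)" if j: "j \<in> {1..s}" for j
      proof -
        have "K j r = N j * (sh s - 1) * (sh (Suc s) - 1)"
          using less.prems Suc \<open>t = Suc s\<close>
          by (simp add: K_def N_def prod.atLeast_Suc_atMost[of "Suc r"] prod.atLeast_Suc_atMost[of "Suc (Suc r)"] mult_ac)
        then have "cst (u * v) * (shi s * K j r) = N j * (cst (u * v) * ((sh s - 1) * shi s * (sh (Suc s) - 1)))"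
          by (simp add: mult_ac)
        moreover have "M j * opP u v w (Suc s) = N j * (opQ u v w s * opP u v w (Suc s))"
          using j Suc by (simp add: M_def N_def mult_ac)
        ultimately have eq: "cst (u * v) * (shi s * K j r) + M j * opP u v w (Suc s) = (N j * cst (u + v + w)) * opR u v w (Suc s) s"
          unfolding mult.assoc[of "N j"] opQ_opP_identity[symmetric]
          by (simp only: distrib_left add.commute)
        have "symm s (Suc s) (N j * cst (u + v + w))"
          unfolding N_def opP_def opQ_def using j Suc
          by (intro symm_mult symm_prod symm_add symm_diff symm_cst symm_sh symm_shi symm_one) auto
        moreover have "alt s (Suc s) (act (opR u v w (Suc s) s) \<beta>)"
          using alt Suc less.prems \<open>t = Suc s\<close> by simp
        moreover have "p j s = p j (Suc s)" using j by (auto simp: p_def pt_def)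
        ultimately have "act (cst (u * v) * (shi s * K j r) + M j * opP u v w (Suc s)) \<beta> (p j) = 0"
          unfolding eq act_mult[of _ "opR _ _ _ _ _"] symm_def alt_def by blast
        moreover have "(p j)(s := p j s - 1) = pt x j r (y(Suc s := ?a, s := ?a - 1))"
          using j Suc by (auto simp: p_def pt_def fun_eq_iff)
        ultimately have "u * v * act (K j r) \<beta> (pt x j r (y(Suc s := ?a, s := ?a - 1))) + act (M j * opP u v w (Suc s)) \<beta> (p j) = 0"
          by (simp add: act_add act_mult[of "cst _"] act_mult[of "shi _"])
        then show ?thesis by (simp add: eq_neg_iff_add_eq_0)
      qed
      ultimately show ?thesis using Suc
        by (simp add: sum_distrib_left sum_negf[symmetric] mult.left_commute[of "u * v"] del: sum.cl_ivl_Suc)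
    qed simp
    have "row_sum u v w (Suc s) x b y = (\<Sum>j\<in>{1..Suc (Suc s)}. ?s j * act (K j (Suc s)) \<beta> (pt x j (Suc s) y))"
      by (subst row_sum_Suc) (use gap less.prems Suc in \<open>auto simp: 1 2 simp del: sum.cl_ivl_Suc\<close>)
    then show ?thesis unfolding Suc K_def .
  qed
qed

subsection \<open>Extended Schur functions as iterated row sums\<close>

definition hat :: "nat \<Rightarrow> (nat \<Rightarrow> int) \<Rightarrow> nat \<Rightarrow> int" where
  "hat j x = (\<lambda>i. if i < j then x i else x (Suc i))"

text \<open>If F is a determinant with entries g_i(x_j), this is the Laplace expansion along an
  added row of ones.\<close>

definition bsum :: "nat \<Rightarrow> ((nat \<Rightarrow> int) \<Rightarrow> 'a::field) \<Rightarrow> (nat \<Rightarrow> int) \<Rightarrow> 'a" where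
  "bsum d F x = (\<Sum>j\<in>{1..Suc d}. (-1) ^ (j - 1) * F (hat j x))"

lemma local_bsum: assumes "local d F" shows "local (Suc d) (bsum d F)"
  unfolding local_def bsum_def
proof (intro allI impI sum.cong refl)
  fix m m' :: "nat \<Rightarrow> int" and j
  assume "\<forall>i. 1 \<le> i \<and> i \<le> Suc d \<longrightarrow> m i = m' i" "j \<in> {1..Suc d}"
  then have "F (hat j m) = F (hat j m')" using assms unfolding local_def hat_def by simp
  then show "(-1) ^ (j - 1) * F (hat j m) = (-1) ^ (j - 1) * F (hat j m')" by simp
qed

text \<open>The transposition exchanges the terms j = t and j = t+1, which have opposite signs. In
  every other term both entries survive as neighbours, at positions t-1, t or t, t+1, and
  alternation of F applies.\<close>

lemma alt_bsum:
  assumes F: "\<And>t. 1 \<le> t \<Longrightarrow> t < d \<Longrightarrow> alt t (Suc t) F" and t: "1 \<le> t" "t < Suc d"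
  shows "alt t (Suc t) (bsum d F)"
proof -
  let ?r = "{1..Suc d} - {t, Suc t}"
  have split: "bsum d F x = (-1) ^ (t - 1) * (F (hat t x) - F (hat (Suc t) x))
      + (\<Sum>j\<in>?r. (-1) ^ (j - 1) * F (hat j x))" for x
  proof -
    have eq: "{1..Suc d} = insert t (insert (Suc t) ?r)" using t by auto
    have "bsum d F x = (-1) ^ (t - 1) * F (hat t x) + ((-1) ^ t * F (hat (Suc t) x) +
       (\<Sum>j\<in>?r. (-1) ^ (j - 1) * F (hat j x)))"
      unfolding bsum_def by (subst eq) simp
    moreover have "(-1) ^ t = - ((-1) ^ (t - 1) :: 'a)" using t by (cases t) auto
    ultimately show ?thesis by (simp add: algebra_simps)
  qed
  have h1: "hat t (x \<circ> transpose t (Suc t)) = hat (Suc t) x" for x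
  proof
    fix i show "hat t (x \<circ> transpose t (Suc t)) i = hat (Suc t) x i"
      by (cases "i = t") (auto simp: hat_def transpose_def)
  qed
  have h2: "hat (Suc t) (x \<circ> transpose t (Suc t)) = hat t x" for x
  proof
    fix i show "hat (Suc t) (x \<circ> transpose t (Suc t)) i = hat t x i"
      by (cases "i = t") (auto simp: hat_def transpose_def)
  qed
  have rest: "\<exists>s. 1 \<le> s \<and> s < d \<and> (\<forall>x. hat j (x \<circ> transpose t (Suc t)) = hat j x \<circ> transpose s (Suc s)) \<and>
      (\<forall>x. x t = x (Suc t) \<longrightarrow> hat j x s = hat j x (Suc s))" if j: "j \<in> ?r" for j
  proof (cases "j < t")
    case True
    then show ?thesis using j t
      by (intro exI[of _ "t - 1"]) (auto simp: hat_def fun_eq_iff transpose_def)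
  next
    case False
    then show ?thesis using j t
      by (intro exI[of _ t]) (auto simp: hat_def fun_eq_iff transpose_def)
  qed
  have rest1: "F (hat j (x \<circ> transpose t (Suc t))) = - F (hat j x)"
    and rest2: "x t = x (Suc t) \<Longrightarrow> F (hat j x) = 0" if "j \<in> ?r" for j x
    using rest[OF that] F unfolding alt_def by metis+
  show ?thesis
    unfolding alt_def
  proof (intro conjI allI impI)
    fix x
    show "bsum d F (x \<circ> transpose t (Suc t)) = - bsum d F x"
      unfolding split h1 h2 by (simp add: rest1 sum_negf algebra_simps)
  next
    fix x :: "nat \<Rightarrow> int" assume x: "x t = x (Suc t)"
    have "hat t x = hat (Suc t) x"
    proof
      fix i show "hat t x i = hat (Suc t) x i"
        using x by (cases "i = t") (auto simp: hat_def)
    qed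
    with x show "bsum d F x = 0" unfolding split by (simp add: rest2)
  qed
qed

text \<open>With \<open>x i = k i + i\<close> the value \<open>asch n X x\<close> is the extended Schur function of \<open>(k n, \<dots>, k 1)\<close>;
  the summand \<open>- int (Suc d)\<close> in the exponent compensates the shift of the coordinates.\<close>

primrec asch :: "nat \<Rightarrow> (nat \<Rightarrow> 'a::field) \<Rightarrow> (nat \<Rightarrow> int) \<Rightarrow> 'a" where
  "asch 0 X x = 1"
| "asch (Suc d) X x = X (Suc d) powi ((\<Sum>i\<in>{1..Suc d}. x i) - int (Suc d)) *
     bsum d (antis d (\<lambda>y. X (Suc d) powi (- (\<Sum>i\<in>{1..d}. y i)) * asch d X y)) x"

section \<open>Alternation and locality of \<open>asch\<close>\<close>

lemma sum_comp_transpose: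
  assumes "1 \<le> t" "t < d" 
  shows "(\<Sum>i\<in>{1..d}. (m \<circ> transpose t (Suc t)) i) = (\<Sum>i\<in>{1..d}. m i :: int)"
  unfolding comp_def
  by (rule sum.permute[symmetric, unfolded comp_def]) (use assms in \<open>auto intro: permutes_swap_id\<close>)

lemma alt_mult_sum:
  assumes "1 \<le> t" "t < d" "alt t (Suc t) f"
  shows "alt t (Suc t) (\<lambda>y. g (\<Sum>i\<in>{1..d}. y i) * f y)"
  using assms(3) unfolding alt_def sum_comp_transpose[OF assms(1,2)] by simp

lemma alt_asch: "1 \<le> t \<Longrightarrow> t < d \<Longrightarrow> alt t (Suc t) (asch d X)"
proof (induction d arbitrary: t)
  case (Suc d)
  have "alt t (Suc t) (bsum d (antis d (\<lambda>y. X (Suc d) powi (- (\<Sum>i\<in>{1..d}. y i)) * asch d X y)))"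
    using Suc.prems by (intro alt_bsum alt_antis alt_mult_sum[where g = "\<lambda>s. X (Suc d) powi (- s)"] Suc.IH)
  from alt_mult_sum[OF Suc.prems this, of "\<lambda>s. X (Suc d) powi (s - int (Suc d))"] show ?case
    by (simp only: asch.simps[abs_def])
qed simp

lemma local_mult_sum:
  assumes "local d f" shows "local d (\<lambda>y. g (\<Sum>i\<in>{1..d}. y i) * f y)"
  unfolding local_def
proof (intro allI impI)
  fix m m' :: "nat \<Rightarrow> int" assume *: "\<forall>i. 1 \<le> i \<and> i \<le> d \<longrightarrow> m i = m' i"
  then have "(\<Sum>i\<in>{1..d}. m i) = (\<Sum>i\<in>{1..d}. m' i)" by (intro sum.cong) auto
  moreover have "f m = f m'" using assms * unfolding local_def by blast
  ultimately show "g (\<Sum>i\<in>{1..d}. m i) * f m = g (\<Sum>i\<in>{1..d}. m' i) * f m'" by simp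
qed

lemma local_asch: "local d (asch d X)"
proof (induction d)
  case 0
  show ?case by (simp add: local_def)
next
  case (Suc d)
  have "local (Suc d) (bsum d (antis d (\<lambda>y. X (Suc d) powi (- (\<Sum>i\<in>{1..d}. y i)) * asch d X y)))"
    by (intro local_bsum local_antis local_mult_sum[where g = "\<lambda>s. X (Suc d) powi (- s)"] Suc.IH) simp
  from local_mult_sum[OF this, of "\<lambda>s. X (Suc d) powi (s - int (Suc d))"] show ?case
    by (simp only: asch.simps[abs_def])
qed

text \<open>Shifting the removed coordinate j has no effect, so \<open>opR\<close> degenerates to
  \<open>opQ\<close> if j is its first index and to \<open>opP\<close> if it is the second; indices
  beyond j move down by one.\<close>

lemma act_opR_hat:
  fixes F :: "(nat \<Rightarrow> int) \<Rightarrow> 'a::field"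
  assumes "1 \<le> p" "p < q" "1 \<le> j"
  shows "act (opR u v w p q) (\<lambda>x. F (hat j x)) = (\<lambda>x. act
    (if p = j then opQ u v w (q - 1) else if q = j then opP u v w p
     else opR u v w (if p < j then p else p - 1) (if q < j then q else q - 1)) F (hat j x))"
proof -
  have h: "hat j (x(i := c)) = (if i = j then hat j x else (hat j x)((if i < j then i else i - 1) := c))"
    if "1 \<le> i" for x i c
    using that assms by (auto simp: hat_def fun_eq_iff)
  have e: "hat j x i = (if i < j then x i else x (Suc i))" for x i by (simp add: hat_def)
  have pq: "p \<noteq> q" "1 \<le> q" using assms by auto
  have h_ne: "hat j (x(i := c)) = (hat j x)((if i < j then i else i - 1) := c)"
    and e_ne: "hat j x (if i < j then i else i - 1) = x i" if "1 \<le> i" "i \<noteq> j" for x i c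
    using that by (auto simp: h e)
  have h_eq: "hat j (x(j := c)) = hat j x" for x c
    using assms by (simp add: h)
  show ?thesis
  proof (rule ext)
    fix x
    have L: "act (opR u v w p q) (\<lambda>x. F (hat j x)) x =
       u * F (hat j (x(p := x p + 1))) + v * F (hat j (x(q := x q - 1))) + w * F (hat j (x(p := x p + 1, q := x q - 1)))"
      by (rule act_opR[OF pq(1)])
    consider "p = j" "q \<noteq> j" "\<not> q < j" | "q = j" "p \<noteq> j" "p < j" | "p \<noteq> j" "q \<noteq> j" using assms by linarith
    then show "act (opR u v w p q) (\<lambda>x. F (hat j x)) x = act
      (if p = j then opQ u v w (q - 1) else if q = j then opP u v w p
       else opR u v w (if p < j then p else p - 1) (if q < j then q else q - 1)) F (hat j x)"
    proof cases
      case 1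
      then show ?thesis unfolding L using h_ne[OF pq(2) 1(2)] e_ne[OF pq(2) 1(2)]
        by (simp add: act_opQ h_eq distrib_right del: fun_upd_apply)
    next
      case 2
      then show ?thesis unfolding L using h_ne[OF assms(1) 2(2)] e_ne[OF assms(1) 2(2)]
        by (simp add: act_opP h_eq distrib_right del: fun_upd_apply)
    next
      case 3
      have "(if p < j then p else p - 1) \<noteq> (if q < j then q else q - 1)"
        using 3 assms by auto
      from act_opR[OF this, of u v w F "hat j x"] show ?thesis
        unfolding L h_ne[OF assms(1) 3(1)] h_ne[OF pq(2) 3(2)] e_ne[OF assms(1) 3(1)] e_ne[OF pq(2) 3(2)]
        using 3 by (simp only: if_False)
    qed
  qed
qed

lemma act_opR_prod_hat:
  assumes "1 \<le> j" "j \<le> Suc d"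
  shows "act (opR_prod u v w (Suc d)) (\<lambda>x. F (hat j x)) = (\<lambda>x. act
    ((\<Prod>i\<in>{1..<j}. opP u v w i) * (\<Prod>i\<in>{j..d}. opQ u v w i) * opR_prod u v w d) F (hat j x))"
proof -
  define s where "s = (\<lambda>(p, q). if p = j then opQ u v w (q - 1) else if q = j then opP u v w p
     else opR u v w (if p < j then p else p - 1) (if q < j then q else q - 1))"
  define A where "A = (\<lambda>q. (j, q)) ` {Suc j..Suc d}"
  define B where "B = (\<lambda>p. (p, j)) ` {1..<j}"
  define C where "C = {(p,q)\<in>pairs (Suc d). p \<noteq> j \<and> q \<noteq> j}"
  have un: "pairs (Suc d) = B \<union> (A \<union> C)"
    using assms by (auto simp: pairs_def A_def B_def C_def image_iff)
  have fin: "finite A" "finite B" "finite C"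
    by (auto simp: A_def B_def C_def intro: finite_subset[OF _ finite_pairs])
  have "prod s (pairs (Suc d)) = prod s B * prod s (A \<union> C)"
    unfolding un by (rule prod.union_disjoint) (use fin in \<open>auto simp: A_def B_def C_def\<close>)
  also have "prod s (A \<union> C) = prod s A * prod s C"
    by (rule prod.union_disjoint) (use fin in \<open>auto simp: A_def B_def C_def\<close>)
  also have "prod s B = (\<Prod>i\<in>{1..<j}. opP u v w i)"
    unfolding B_def by (subst prod.reindex) (auto simp: inj_on_def s_def intro!: prod.cong)
  also have "prod s A = (\<Prod>i\<in>{Suc j..Suc d}. opQ u v w (i - 1))"
    unfolding A_def by (subst prod.reindex) (auto simp: inj_on_def s_def intro!: prod.cong)
  also have "\<dots> = (\<Prod>i\<in>{j..d}. opQ u v w i)"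
    by (subst prod.atLeast_Suc_atMost_Suc_shift) (simp add: comp_def)
  also have "prod s C = opR_prod u v w d"
    unfolding opR_prod_def
    by (rule prod.reindex_bij_witness[of _ "map_prod (\<lambda>p. if p < j then p else Suc p) (\<lambda>p. if p < j then p else Suc p)"
          "map_prod (\<lambda>p. if p < j then p else p - 1) (\<lambda>p. if p < j then p else p - 1)"])
      (use assms in \<open>auto simp: C_def pairs_def s_def split: if_splits\<close>)
  finally have "prod s (pairs (Suc d)) = (\<Prod>i\<in>{1..<j}. opP u v w i) * (\<Prod>i\<in>{j..d}. opQ u v w i) * opR_prod u v w d"
    by (simp add: mult.assoc)
  moreover have "act (opR_prod u v w (Suc d)) (\<lambda>x. F (hat j x)) = (\<lambda>x. act (prod s (pairs (Suc d))) F (hat j x))"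
    unfolding opR_prod_def
  proof (rule act_prod_intertwine[where \<Phi> = "\<lambda>F x. F (hat j x)"])
    fix i and f :: "(nat \<Rightarrow> int) \<Rightarrow> 'a" assume i: "i \<in> pairs (Suc d)"
    obtain p q where [simp]: "i = (p, q)" by (cases i)
    have "1 \<le> p" "p < q" using i by (auto simp: pairs_def)
    from act_opR_hat[OF this assms(1), of u v w f]
    show "act (case i of (p, q) \<Rightarrow> opR u v w p q) (\<lambda>x. f (hat j x)) = (\<lambda>x. act (s i) f (hat j x))"
      by (simp add: s_def)
  qed
  ultimately show ?thesis by simp
qed

lemma sum_upd:
  fixes m :: "nat \<Rightarrow> int"
  assumes "i \<in> {1..n}" shows "(\<Sum>k\<in>{1..n}. (m(i := c)) k) = (\<Sum>k\<in>{1..n}. m k) + (c - m i :: int)"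
proof -
  have "(\<Sum>k\<in>{1..n}. (m(i := c)) k) = c + (\<Sum>k\<in>{1..n} - {i}. m k)"
    using assms by (subst sum.remove[of _ i]) auto
  moreover have "(\<Sum>k\<in>{1..n}. m k) = m i + (\<Sum>k\<in>{1..n} - {i}. m k)"
    using assms by (subst sum.remove[of _ i]) auto
  ultimately show ?thesis by simp
qed

text \<open>\<open>sh p\<close> raises and \<open>shi q\<close> lowers the coordinate sum by one,
  and their product preserves it. This moves a variable X into the parameters u and v.\<close>

lemma act_opR_prod_powi:
  assumes "\<xi> \<noteq> 0"
  shows "act (opR_prod u v w n) (\<lambda>x. \<xi> powi (\<Sum>i\<in>{1..n}. x i) * f x) =
    (\<lambda>x. \<xi> powi (\<Sum>i\<in>{1..n}. x i) * act (opR_prod (u * \<xi>) (v * inverse \<xi>) w n) f x)"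
  unfolding opR_prod_def
proof (rule act_prod_intertwine[where \<Phi> = "\<lambda>f x. \<xi> powi (\<Sum>i\<in>{1..n}. x i) * f x"])
  fix i and f :: "(nat \<Rightarrow> int) \<Rightarrow> 'a" assume i: "i \<in> pairs n"
  obtain p q where [simp]: "i = (p, q)" by (cases i)
  have pq: "p \<noteq> q" "p \<in> {1..n}" "q \<in> {1..n}" using i by (auto simp: pairs_def)
  define S where "S x = (\<Sum>i\<in>{1..n}. x i)" for x :: "nat \<Rightarrow> int"
  have S: "S (x(p := x p + 1)) = S x + 1" "S (x(q := x q - 1)) = S x - 1"
    "S (x(p := x p + 1, q := x q - 1)) = S x" for x
    unfolding S_def sum_upd[OF pq(2)] sum_upd[OF pq(3)] using pq(1) by auto
  have P: "\<xi> powi (S x + 1) = \<xi> powi S x * \<xi>" "\<xi> powi (S x - 1) = \<xi> powi S x * inverse \<xi>" for x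
    using assms by (simp_all add: power_int_add power_int_diff divide_inverse)
  show "act (case i of (p, q) \<Rightarrow> opR u v w p q) (\<lambda>x. \<xi> powi (\<Sum>i\<in>{1..n}. x i) * f x) =
     (\<lambda>x. \<xi> powi (\<Sum>i\<in>{1..n}. x i) * act (case i of (p, q) \<Rightarrow> opR (u * \<xi>) (v * inverse \<xi>) w p q) f x)"
    unfolding S_def[symmetric] \<open>i = (p, q)\<close> prod.case
    by (rule ext) (simp only: act_opR[OF pq(1)] S P distrib_left mult_ac)
qed

section \<open>The recursion on the operator side\<close>

definition opsch :: "'a::field \<Rightarrow> 'a \<Rightarrow> 'a \<Rightarrow> nat \<Rightarrow> (nat \<Rightarrow> 'a) \<Rightarrow> (nat \<Rightarrow> int) \<Rightarrow> 'a" where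
  "opsch u v w n X k = act (opR_prod u v w n) (asch n X) (\<lambda>i. k i + int i)"

definition strict_rows :: "nat \<Rightarrow> (nat \<Rightarrow> int) \<Rightarrow> (nat \<Rightarrow> int) set" where
  "strict_rows d k = {l. (\<forall>i\<in>{1..d}. k i \<le> l i \<and> l i \<le> k (Suc i)) \<and>
     (\<forall>i\<in>{1..<d}. l i < l (Suc i)) \<and> (\<forall>i. i \<notin> {1..d} \<longrightarrow> l i = 0)}"

text \<open>The powers of \<xi> at u and v are the contributions of r and -l to the exponent
  \<open>d_row\<close>; with them each case is \<open>wt\<close> at the parameters
  \<open>u * \<xi>\<close> and \<open>v * inverse \<xi>\<close>.\<close>

definition step_wt :: "'a::field \<Rightarrow> 'a \<Rightarrow> 'a \<Rightarrow> 'a \<Rightarrow> int \<Rightarrow> int \<Rightarrow> int \<Rightarrow> 'a" where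
  "step_wt u v w \<xi> a b z = (if z = a then v * inverse \<xi> else if z = b then u * \<xi> else w + u * \<xi> + v * inverse \<xi>)"

lemma opsch_Suc:
  fixes k :: "nat \<Rightarrow> int" and X :: "nat \<Rightarrow> 'a::field"
  assumes k: "\<forall>i\<in>{1..d}. k i < k (Suc i)" and X: "X (Suc d) \<noteq> 0"
  shows "opsch u v w (Suc d) X k = (\<Sum>l\<in>strict_rows d k. X (Suc d) powi ((\<Sum>i\<in>{1..Suc d}. k i) - (\<Sum>i\<in>{1..d}. l i)) *
     (\<Prod>i\<in>{1..d}. step_wt u v w (X (Suc d)) (k i) (k (Suc i)) (l i)) * opsch u v w d X l)"
proof -
  define \<xi> where "\<xi> = X (Suc d)"
  have \<xi>: "\<xi> \<noteq> 0" using X by (simp add: \<xi>_def)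
  have pd: "\<xi> powi (r - s) = \<xi> powi r * \<xi> powi (- s)" for r s
    using power_int_add[of \<xi> r "- s"] \<xi> by simp
  define U V where "U = u * \<xi>" and "V = v * inverse \<xi>"
  define x where "x i = k i + int i" for i
  define a where "a y = \<xi> powi (- (\<Sum>i\<in>{1..d}. y i)) * asch d X y" for y
  define \<alpha> where "\<alpha> = antis d a"
  define \<beta> where "\<beta> = act (opR_prod U V w d) \<alpha>"
  define b where "b = act (opR_prod U V w d) a"
  \<comment> \<open>Continued beyond d so that \<open>pt x j d y\<close> and \<open>hat j x\<close>
    agree as functions, not only on \<open>{1..d}\<close>.\<close>
  define y where "y i = (if 1 \<le> i then x (Suc i) else x i)" for i
  let ?S = "\<lambda>n x. \<Sum>i\<in>{1..n}. x i :: int"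
  have alt_a: "alt t (Suc t) a" if "1 \<le> t" "t < d" for t
    unfolding a_def[abs_def] using that
    by (intro alt_mult_sum[where g = "\<lambda>s. \<xi> powi (- s)"] alt_asch)
  \<comment> \<open>Operators commute, so the differences reach the antidifferences inside \<beta>
    past the operator product.\<close>
  have b1: "b = act (\<Prod>i\<in>{1..d}. sh i - 1) \<beta>"
    unfolding b_def \<beta>_def \<alpha>_def act_mult[symmetric]
    by (subst mult.commute) (simp only: act_mult act_diff_antis)
  have b2: "b z = \<xi> powi (- ?S d z) * act (opR_prod u v w d) (asch d X) z" for z
  proof -
    have "asch d X = (\<lambda>y. \<xi> powi ?S d y * a y)"
      using \<xi> by (auto simp: a_def fun_eq_iff power_int_minus)
    then have "act (opR_prod u v w d) (asch d X) z = \<xi> powi (?S d z) * b z"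
      using act_opR_prod_powi[OF \<xi>, of u v w d a] by (simp add: b_def U_def V_def)
    then show ?thesis using \<xi> by (simp add: power_int_minus)
  qed
  have local_b: "local d b"
    unfolding b_def a_def[abs_def] by (intro local_act local_mult_sum[where g = "\<lambda>s. \<xi> powi (- s)"] local_asch)
  have gap: "\<forall>i\<in>{1..d}. x i + 2 \<le> x (Suc i)"
  proof
    fix i assume "i \<in> {1..d}"
    then have "k i < k (Suc i)" using k by blast
    then show "x i + 2 \<le> x (Suc i)" by (simp add: x_def)
  qed
  have "opsch u v w (Suc d) X k = act (opR_prod u v w (Suc d)) (\<lambda>x. \<xi> powi ?S (Suc d) x * (\<xi> powi (- int (Suc d)) * bsum d \<alpha> x)) x"
    unfolding opsch_def asch.simps[abs_def] x_def \<xi>_def[symmetric] \<alpha>_def a_def[abs_def]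
    by (simp only: pd[of "sum _ _"] mult.assoc)
  also have "\<dots> = \<xi> powi ?S (Suc d) x * act (opR_prod U V w (Suc d)) (\<lambda>x. \<Sum>j\<in>{1..Suc d}. (\<xi> powi (- int (Suc d)) * (-1) ^ (j - 1)) * \<alpha> (hat j x)) x"
    unfolding act_opR_prod_powi[OF \<xi>] U_def V_def
    unfolding bsum_def sum_distrib_left by (simp only: mult.assoc)
  also have "\<dots> = \<xi> powi ?S (Suc d) x * (\<xi> powi (- int (Suc d)) * (\<Sum>j\<in>{1..Suc d}. (-1) ^ (j - 1) *
     act ((\<Prod>i\<in>{1..<j}. opP U V w i) * (\<Prod>i\<in>{j..d}. opQ U V w i) * opR_prod U V w d) \<alpha> (hat j x)))"
  proof -
    have *: "act (opR_prod U V w (Suc d)) (\<lambda>x. \<alpha> (hat j x)) x = act ((\<Prod>i\<in>{1..<j}. opP U V w i) *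
        (\<Prod>i\<in>{j..d}. opQ U V w i) * opR_prod U V w d) \<alpha> (hat j x)" if "j \<in> {1..Suc d}" for j
      by (subst act_opR_prod_hat) (use that in auto)
    show ?thesis
      unfolding act_linear
      unfolding sum_distrib_left mult.assoc[of "\<xi> powi _"]
      by (rule sum.cong[OF refl]) (simp only: *)
  qed
  also have "(\<Sum>j\<in>{1..Suc d}. (-1) ^ (j - 1) *
     act ((\<Prod>i\<in>{1..<j}. opP U V w i) * (\<Prod>i\<in>{j..d}. opQ U V w i) * opR_prod U V w d) \<alpha> (hat j x)) =
     row_sum U V w d x b y"
  proof -
    have "pt x j d y = hat j x" if "j \<in> {1..Suc d}" for j
      using that by (auto simp: pt_def hat_def y_def fun_eq_iff)
    \<comment> \<open>The extra factor completes the operator product inside \<beta> to one that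
      preserves alternation.\<close>
    moreover have "alt t (Suc t) (act (opR U V w (Suc t) t) \<beta>)" if "1 \<le> t" "t < d" for t
      using symm_opR_prod[OF that, of U V w] alt_antis[OF that alt_a[OF that]]
      unfolding symm_def \<beta>_def \<alpha>_def act_mult[symmetric] by blast
    ultimately show ?thesis
      by (subst row_sum_eq[OF gap _ b1]) (auto simp: \<beta>_def act_mult intro!: sum.cong)
  qed
  also have "\<xi> powi ?S (Suc d) x * (\<xi> powi (- int (Suc d)) * row_sum U V w d x b y) =
     (\<Sum>z\<in>rows d x y. \<xi> powi (?S (Suc d) x - int (Suc d)) * ((\<Prod>i\<in>{1..d}. wt U V w (x i) (x (Suc i)) (z i)) * b z))"
    unfolding row_sum_def sum_distrib_left by (simp only: pd mult.assoc)
  also have "\<dots> = (\<Sum>l\<in>strict_rows d k. \<xi> powi (?S (Suc d) k - ?S d l) *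
     (\<Prod>i\<in>{1..d}. step_wt u v w \<xi> (k i) (k (Suc i)) (l i)) * opsch u v w d X l)"
  proof (rule sum.reindex_bij_witness[of _ "\<lambda>l i. if i \<in> {1..d} then l i + int i else y i"
        "\<lambda>z i. if i \<in> {1..d} then z i - int i else 0"], goal_cases)
    case (1 z)
    then show ?case by (auto simp: rows_def fun_eq_iff)
  next
    case (2 z)
    then have z: "\<And>i. i \<in> {1..d} \<Longrightarrow> x i \<le> z i \<and> z i < x (Suc i)"
      "\<And>i. i \<in> {1..<d} \<Longrightarrow> \<not> (z i = x (Suc i) - 1 \<and> z (Suc i) = x (Suc i))"
      unfolding rows_def by auto
    \<comment> \<open>The bounds give \<open>z i < x (Suc i)\<close> and
      \<open>x (Suc i) \<le> z (Suc i)\<close>; after unshifting, equality remains possible only if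
      both are tight, which is the excluded case.\<close>
    have "z i - int i < z (Suc i) - int (Suc i)" if "i \<in> {1..<d}" for i
      using z(1)[of i] z(1)[of "Suc i"] z(2)[OF that] that by auto
    moreover have "k i \<le> z i - int i \<and> z i - int i \<le> k (Suc i)" if "i \<in> {1..d}" for i
      using z(1)[OF that] by (auto simp: x_def)
    ultimately show ?case unfolding strict_rows_def by auto
  next
    case (3 l)
    then show ?case by (auto simp: strict_rows_def fun_eq_iff)
  next
    case (4 l)
    then have l: "\<And>i. i \<in> {1..d} \<Longrightarrow> k i \<le> l i \<and> l i \<le> k (Suc i)"
      "\<And>i. i \<in> {1..<d} \<Longrightarrow> l i < l (Suc i)"
      unfolding strict_rows_def by auto
    have "\<not> (l i + int i = x (Suc i) - 1 \<and> l (Suc i) + int (Suc i) = x (Suc i))" if "i \<in> {1..<d}" for i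
      using l(2)[OF that] by auto
    then show ?case using l(1) unfolding rows_def x_def by auto
  next
    case (5 z)
    let ?l = "\<lambda>i. if i \<in> {1..d} then z i - int i else 0"
    have A: "(\<Prod>i\<in>{1..d}. wt U V w (x i) (x (Suc i)) (z i)) = (\<Prod>i\<in>{1..d}. step_wt u v w \<xi> (k i) (k (Suc i)) (?l i))"
      by (rule prod.cong) (auto simp: wt_def step_wt_def U_def V_def x_def)
    have B: "b z = \<xi> powi (- ?S d (\<lambda>i. ?l i + int i)) * opsch u v w d X ?l"
      unfolding opsch_def b2[symmetric] by (rule local_b[unfolded local_def, rule_format]) auto
    have C: "\<xi> powi (?S (Suc d) x - int (Suc d)) * \<xi> powi (- ?S d (\<lambda>i. ?l i + int i)) = \<xi> powi (?S (Suc d) k - ?S d ?l)"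
    proof -
      have "?S (Suc d) x = ?S (Suc d) k + ?S (Suc d) int"
        unfolding x_def by (rule sum.distrib)
      moreover have "?S d (\<lambda>i. ?l i + int i) = ?S d ?l + ?S d int"
        by (rule sum.distrib)
      moreover have "?S (Suc d) int = ?S d int + int (Suc d)" by simp
      ultimately have "?S (Suc d) x - int (Suc d) + - ?S d (\<lambda>i. ?l i + int i) = ?S (Suc d) k - ?S d ?l" by linarith
      then show ?thesis by (subst power_int_add[symmetric]) (use \<xi> in simp_all)
    qed
    show ?case unfolding A B C[symmetric] by (simp only: mult_ac)
  qed
  finally show ?thesis unfolding \<xi>_def .
qed

subsection \<open>Removing the bottom row of a monotone triangle\<close>

lemma finite_strict_rows: "finite (strict_rows d k)"
proof -
  let ?B = "\<Union>i\<in>{1..d}. {k i..k (Suc i)}"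
  have "finite {f. \<forall>i. (i \<in> {1..d} \<longrightarrow> f i \<in> ?B) \<and> (i \<notin> {1..d} \<longrightarrow> f i = 0)}"
    by (rule finite_set_of_finite_funs) auto
  moreover have "strict_rows d k \<subseteq> {f. \<forall>i. (i \<in> {1..d} \<longrightarrow> f i \<in> ?B) \<and> (i \<notin> {1..d} \<longrightarrow> f i = 0)}"
    unfolding strict_rows_def by fastforce
  ultimately show ?thesis by (rule rev_finite_subset)
qed

definition add_row :: "nat \<Rightarrow> (nat \<Rightarrow> int) \<Rightarrow> (nat \<Rightarrow> nat \<Rightarrow> int) \<Rightarrow> nat \<Rightarrow> nat \<Rightarrow> int" where
  "add_row n k M = M(n := (\<lambda>j. if 1 \<le> j \<and> j \<le> n then k j else 0))"

lemma monotone_triangle_add_row: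
  assumes l: "l \<in> strict_rows d k" and M: "monotone_triangle d l M" and k: "\<forall>i\<in>{1..d}. k i < k (Suc i)"
  shows "monotone_triangle (Suc d) k (add_row (Suc d) k M)"
proof -
  have Md: "M d j = l j" if "1 \<le> j" "j \<le> d" for j using M that unfolding monotone_triangle_def by blast
  show ?thesis
    unfolding monotone_triangle_def
  proof (intro conjI allI impI)
    fix i j assume "\<not> (1 \<le> j \<and> j \<le> i \<and> i \<le> Suc d)"
    then show "add_row (Suc d) k M i j = 0"
      using M unfolding monotone_triangle_def add_row_def by auto
  next
    fix j assume "1 \<le> j \<and> j \<le> Suc d"
    then show "add_row (Suc d) k M (Suc d) j = k j" by (simp add: add_row_def)
  next
    fix i j assume *: "1 \<le> j \<and> j \<le> i \<and> i < Suc d"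
    then show "add_row (Suc d) k M (i + 1) j \<le> add_row (Suc d) k M i j"
      "add_row (Suc d) k M i j \<le> add_row (Suc d) k M (i + 1) (j + 1)"
      using M l Md unfolding monotone_triangle_def strict_rows_def
      by (cases "i = d"; force simp: add_row_def)+
  next
    fix i j assume *: "1 \<le> j \<and> j < i \<and> i \<le> Suc d"
    then show "add_row (Suc d) k M i j < add_row (Suc d) k M i (j + 1)"
      using M k unfolding monotone_triangle_def
      by (cases "i = Suc d") (auto simp: add_row_def)
  qed
qed

lemma monotone_triangle_del_row:
  assumes M: "monotone_triangle (Suc d) k M"
  shows "M d \<in> strict_rows d k" "monotone_triangle d (M d) (M(Suc d := (\<lambda>_. 0)))"
    "add_row (Suc d) k (M(Suc d := (\<lambda>_. 0))) = M"
proof -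
  have zero: "M i j = 0" if "\<not> (1 \<le> j \<and> j \<le> i \<and> i \<le> Suc d)" for i j
    using M that unfolding monotone_triangle_def by blast
  have bot: "M (Suc d) j = k j" if "1 \<le> j" "j \<le> Suc d" for j
    using M that unfolding monotone_triangle_def by blast
  have inter: "M (Suc i) j \<le> M i j" "M i j \<le> M (Suc i) (Suc j)" if "1 \<le> j" "j \<le> i" "i < Suc d" for i j
    using M that unfolding monotone_triangle_def by auto
  have strict: "M i j < M i (Suc j)" if "1 \<le> j" "j < i" "i \<le> Suc d" for i j
    using M that unfolding monotone_triangle_def by auto
  show "M d \<in> strict_rows d k"
    unfolding strict_rows_def using zero[of _ d] inter[of _ d] strict[of _ d] bot by auto
  show "monotone_triangle d (M d) (M(Suc d := (\<lambda>_. 0)))"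
    unfolding monotone_triangle_def using zero inter strict by (auto simp: le_Suc_eq)
  show "add_row (Suc d) k (M(Suc d := (\<lambda>_. 0))) = M"
    using zero[of _ "Suc d"] bot by (auto simp: add_row_def fun_eq_iff)
qed

lemma add_row_row:
  assumes "l \<in> strict_rows d k" "monotone_triangle d l M"
  shows "add_row (Suc d) k M d = l"
proof
  fix j
  show "add_row (Suc d) k M d j = l j"
    using assms unfolding monotone_triangle_def strict_rows_def add_row_def
    by (cases "1 \<le> j \<and> j \<le> d") auto
qed

lemma add_row_del_row:
  assumes "monotone_triangle d l M"
  shows "(add_row (Suc d) k M)(Suc d := (\<lambda>_. 0)) = M"
proof -
  have "M (Suc d) j = 0" for j using assms unfolding monotone_triangle_def by auto
  then show ?thesis by (auto simp: add_row_def fun_eq_iff)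
qed

lemma monotone_triangles_Suc:
  assumes "\<forall>i\<in>{1..d}. k i < k (Suc i)"
  shows "{M. monotone_triangle (Suc d) k M} =
    (\<lambda>(l, M). add_row (Suc d) k M) ` (SIGMA l:strict_rows d k. {M. monotone_triangle d l M})"
proof (intro equalityI subsetI)
  fix M assume "M \<in> {M. monotone_triangle (Suc d) k M}"
  then have M: "monotone_triangle (Suc d) k M" by simp
  show "M \<in> (\<lambda>(l, M). add_row (Suc d) k M) ` (SIGMA l:strict_rows d k. {M. monotone_triangle d l M})"
    using monotone_triangle_del_row[OF M]
    by (intro image_eqI[of _ _ "(M d, M(Suc d := (\<lambda>_. 0)))"]) auto
qed (use monotone_triangle_add_row assms in auto)

lemma finite_monotone_triangles:
  assumes "\<forall>i\<in>{1..<n}. k i < k (Suc i)" shows "finite {M. monotone_triangle n k M}"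
  using assms
proof (induction n arbitrary: k)
  case 0
  have "{M. monotone_triangle 0 k M} \<subseteq> {\<lambda>_ _. 0}"
    by (auto simp: monotone_triangle_def fun_eq_iff)
  then show ?case by (rule finite_subset) simp
next
  case (Suc d)
  then have "\<forall>i\<in>{1..d}. k i < k (Suc i)" by auto
  moreover have "finite {M. monotone_triangle d l M}" if "l \<in> strict_rows d k" for l
    using that by (intro Suc.IH) (auto simp: strict_rows_def)
  ultimately show ?case
    by (simp add: monotone_triangles_Suc finite_strict_rows)
qed

section \<open>Weights and the recursion on the side of triangles\<close>

lemma prod_cases_card:
  fixes a b c :: "'a::comm_monoid_mult"
  assumes "finite A"
  shows "(\<Prod>i\<in>A. if P i then a else if Q i then b else c) =
    a ^ card {i\<in>A. P i} * b ^ card {i\<in>A. \<not> P i \<and> Q i} * c ^ card {i\<in>A. \<not> P i \<and> \<not> Q i}"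
  using assms
proof (induction A rule: finite_induct)
  case (insert x A)
  have "{i \<in> insert x A. R i} = (if R x then insert x {i\<in>A. R i} else {i\<in>A. R i})" for R by auto
  then show ?case using insert by (simp add: mult_ac)
qed simp

text \<open>The statistics of rows \<open>i < d\<close> see only rows up to d, so the new bottom row
  contributes just the counts of row d and the factor of \<open>X (Suc d)\<close>.\<close>

lemma W0_add_row:
  fixes X :: "nat \<Rightarrow> 'a::field"
  assumes l: "l \<in> strict_rows d k" and M: "monotone_triangle d l M"
    and k: "\<forall>i\<in>{1..d}. k i < k (Suc i)" and X: "X (Suc d) \<noteq> 0"
  shows "W0 (Suc d) u v w X (add_row (Suc d) k M) =
     X (Suc d) powi ((\<Sum>i\<in>{1..Suc d}. k i) - (\<Sum>i\<in>{1..d}. l i)) *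
     (\<Prod>i\<in>{1..d}. step_wt u v w (X (Suc d)) (k i) (k (Suc i)) (l i)) * W0 d u v w X M"
proof -
  define N where "N = add_row (Suc d) k M"
  define \<xi> where "\<xi> = X (Suc d)"
  have low: "N i = M i" if "i \<le> d" for i using that by (simp add: N_def add_row_def)
  have Nd: "N d = l" unfolding N_def by (rule add_row_row[OF l M])
  have top: "N (Suc d) j = k j" if "1 \<le> j" "j \<le> Suc d" for j using that by (simp add: N_def add_row_def)
  have r: "r_row N i = r_row M i" and ll: "l_row N i = l_row M i" and s: "s_row N i = s_row M i" if "i < d" for i
    using that low by (simp_all add: r_row_def l_row_def s_row_def)
  \<comment> \<open>For \<open>d = 0\<close> the left sum is empty while \<open>f N d\<close> is
    \<open>f N 0\<close>, hence the second condition.\<close>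
  have sum1: "(\<Sum>i=1..Suc d - 1. f N i) = (\<Sum>i=1..d - 1. f M i) + f N d"
    if "\<And>i. i < d \<Longrightarrow> f N i = f M i" "f N 0 = 0" for f :: "(nat \<Rightarrow> nat \<Rightarrow> int) \<Rightarrow> nat \<Rightarrow> nat"
    using that by (cases d) auto
  have rt: "r_total (Suc d) N = r_total d M + r_row N d"
    unfolding r_total_def by (rule sum1) (use r in \<open>auto simp: r_row_def\<close>)
  have lt: "l_total (Suc d) N = l_total d M + l_row N d"
    unfolding l_total_def by (rule sum1) (use ll in \<open>auto simp: l_row_def\<close>)
  have dr: "d_row N i = d_row M i" if "i \<in> {1..d}" for i
    using that unfolding d_row_def by (auto simp: low r ll)
  have drow: "d_row N (Suc d) = ((\<Sum>i\<in>{1..Suc d}. k i) - (\<Sum>i\<in>{1..d}. l i)) + int (r_row N d) - int (l_row N d)"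
  proof -
    have "(\<Sum>j=1..Suc d. N (Suc d) j) = (\<Sum>i\<in>{1..Suc d}. k i)"
      by (rule sum.cong) (use top in auto)
    then show ?thesis by (simp add: d_row_def Nd)
  qed
  have kl: "k i < k (Suc i)" "k i \<le> l i" "l i \<le> k (Suc i)" if "i \<in> {1..d}" for i
    using that k l by (auto simp: strict_rows_def)
  have "(\<Prod>i\<in>{1..d}. step_wt u v w \<xi> (k i) (k (Suc i)) (l i)) =
     (v * inverse \<xi>) ^ card {i\<in>{1..d}. l i = k i} * (u * \<xi>) ^ card {i\<in>{1..d}. \<not> l i = k i \<and> l i = k (Suc i)} *
     (w + u * \<xi> + v * inverse \<xi>) ^ card {i\<in>{1..d}. \<not> l i = k i \<and> \<not> l i = k (Suc i)}"
    unfolding step_wt_def by (rule prod_cases_card) simp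
  also have "{i\<in>{1..d}. l i = k i} = {j. 1 \<le> j \<and> j \<le> d \<and> N d j = N (d + 1) j}"
    using top Nd by auto
  \<comment> \<open>Strictness of k makes the two leanings exclusive, so testing for left first
    loses no right-leaning entry.\<close>
  also have "{i\<in>{1..d}. \<not> l i = k i \<and> l i = k (Suc i)} = {j. 1 \<le> j \<and> j \<le> d \<and> N d j = N (d + 1) (j + 1)}"
    using top Nd kl(1) by force
  also have "{i\<in>{1..d}. \<not> l i = k i \<and> \<not> l i = k (Suc i)} = {j. 1 \<le> j \<and> j \<le> d \<and> N (d+1) j < N d j \<and> N d j < N (d + 1) (j + 1)}"
    using top Nd kl by (auto simp: order_less_le)
  finally have pr: "(\<Prod>i\<in>{1..d}. step_wt u v w \<xi> (k i) (k (Suc i)) (l i)) =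
     (v * inverse \<xi>) ^ l_row N d * (u * \<xi>) ^ r_row N d * (w + u * \<xi> + v * inverse \<xi>) ^ s_row N d"
    unfolding l_row_def r_row_def s_row_def .
  have pw: "\<xi> powi (e + int a - int b) = \<xi> powi e * \<xi> ^ a * inverse \<xi> ^ b" for e a b
    using X by (simp add: \<xi>_def power_int_add power_int_diff power_inverse divide_inverse)
  have "(\<Prod>i=1..d. X i powi d_row N i * (w + u * X i + v * inverse (X i)) ^ s_row N (i - 1)) =
     (\<Prod>i=1..d. X i powi d_row M i * (w + u * X i + v * inverse (X i)) ^ s_row M (i - 1))"
    by (rule prod.cong) (auto simp: dr s)
  then show ?thesis
    unfolding N_def[symmetric] \<xi>_def[symmetric] pr
    by (simp add: W0_def rt lt drow pw \<xi>_def[symmetric] power_add power_mult_distrib mult_ac)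
qed

lemma sum_W0_eq_opsch:
  fixes X :: "nat \<Rightarrow> 'a::field"
  assumes "\<forall>i\<in>{1..<n}. k i < k (Suc i)" "\<forall>i\<in>{1..n}. X i \<noteq> 0"
  shows "(\<Sum>M\<in>{M. monotone_triangle n k M}. W0 n u v w X M) = opsch u v w n X k"
  using assms
proof (induction n arbitrary: k)
  case 0
  have "{M. monotone_triangle 0 k M} = {\<lambda>_ _. 0}"
    by (auto simp: monotone_triangle_def fun_eq_iff)
  moreover have "pairs 0 = {}" by (auto simp: pairs_def)
  ultimately show ?case
    by (simp add: W0_def r_total_def l_total_def opsch_def opR_prod_def)
next
  case (Suc d)
  then have k: "\<forall>i\<in>{1..d}. k i < k (Suc i)" and X: "X (Suc d) \<noteq> 0" by auto
  let ?T = "\<lambda>l. {M. monotone_triangle d l M}"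
  let ?c = "\<lambda>l. X (Suc d) powi ((\<Sum>i\<in>{1..Suc d}. k i) - (\<Sum>i\<in>{1..d}. l i)) *
     (\<Prod>i\<in>{1..d}. step_wt u v w (X (Suc d)) (k i) (k (Suc i)) (l i))"
  have inc: "\<forall>i\<in>{1..<d}. l i < l (Suc i)" if "l \<in> strict_rows d k" for l
    using that by (auto simp: strict_rows_def)
  have inj: "inj_on (\<lambda>(l, M). add_row (Suc d) k M) (SIGMA l:strict_rows d k. ?T l)"
    by (rule inj_on_inverseI[of _ "\<lambda>M. (M d, M(Suc d := (\<lambda>_. 0)))"])
      (auto simp: add_row_row add_row_del_row)
  have "(\<Sum>M\<in>{M. monotone_triangle (Suc d) k M}. W0 (Suc d) u v w X M) =
     (\<Sum>(l, M)\<in>(SIGMA l:strict_rows d k. ?T l). W0 (Suc d) u v w X (add_row (Suc d) k M))"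
    unfolding monotone_triangles_Suc[OF k] by (subst sum.reindex[OF inj]) (simp add: case_prod_unfold)
  also have "\<dots> = (\<Sum>l\<in>strict_rows d k. \<Sum>M\<in>?T l. W0 (Suc d) u v w X (add_row (Suc d) k M))"
    using inc by (subst sum.Sigma) (auto simp: finite_strict_rows intro: finite_monotone_triangles)
  also have "\<dots> = (\<Sum>l\<in>strict_rows d k. ?c l * (\<Sum>M\<in>?T l. W0 d u v w X M))"
    unfolding sum_distrib_left by (intro sum.cong refl) (rule W0_add_row, use k X in auto)
  also have "\<dots> = (\<Sum>l\<in>strict_rows d k. ?c l * opsch u v w d X l)"
    using Suc.prems inc by (intro sum.cong refl) (subst Suc.IH, auto)
  finally show ?case by (subst opsch_Suc) (use k X in auto)
qed

subsection \<open>Alternating functions under permutations\<close>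

definition alternating :: "nat \<Rightarrow> ((nat \<Rightarrow> int) \<Rightarrow> 'a::field) \<Rightarrow> bool" where
  "alternating n f \<longleftrightarrow> (\<forall>t. 1 \<le> t \<and> t < n \<longrightarrow> alt t (Suc t) f)"

text \<open>The transposition of a and c+1 is that of a and c conjugated by the adjacent one of c
  and c+1, so the sign changes three times.\<close>

lemma alternating_transpose:
  assumes "alternating n f" "1 \<le> a" "a < b" "b \<le> n"
  shows "f (m \<circ> transpose a b) = - f m"
  using assms(3,4)
proof (induction b arbitrary: m rule: less_induct)
  case (less b)
  then obtain c where b: "b = Suc c" by (cases b) auto
  show ?case
  proof (cases "c = a")
    case True
    have "alt a (Suc a) f" using assms less.prems b True unfolding alternating_def by auto
    then show ?thesis unfolding alt_def b True by blast
  next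
    case False
    let ?t = "transpose c (Suc c)"
    have "alt c (Suc c) f" using assms less.prems b False unfolding alternating_def by auto
    then have adj: "f (m \<circ> ?t) = - f m" for m unfolding alt_def by blast
    have "transpose a (Suc c) = ?t \<circ> transpose a c \<circ> ?t"
      using False less.prems b by (auto simp: fun_eq_iff transpose_def)
    then have "f (m \<circ> transpose a b) = f (((m \<circ> ?t) \<circ> transpose a c) \<circ> ?t)"
      by (simp add: b comp_assoc)
    moreover have "f ((m \<circ> ?t) \<circ> transpose a c) = - f (m \<circ> ?t)"
      by (rule less.IH) (use less.prems b False in auto)
    ultimately show ?thesis by (simp only: adj minus_minus)
  qed
qed

text \<open>Antisymmetry would not suffice in characteristic 2; instead the equal entries are
  brought next to each other.\<close>

lemma alternating_eq_zero:
  assumes "alternating n f" "1 \<le> a" "a < b" "b \<le> n" "m a = m b"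
  shows "f m = 0"
proof (cases "b = Suc a")
  case True
  then show ?thesis using assms unfolding alternating_def alt_def by auto
next
  case False
  let ?m = "m \<circ> transpose (Suc a) b"
  have "?m a = ?m (Suc a)" using assms False by (auto simp: transpose_def)
  then have "f ?m = 0" using assms unfolding alternating_def alt_def by auto
  moreover have "f ?m = - f m" by (rule alternating_transpose) (use assms False in auto)
  ultimately show ?thesis by simp
qed

lemma alternating_permutes:
  assumes f: "alternating n f" and p: "p permutes {1..n}"
  shows "f (m \<circ> p) = of_int (sign p) * f m"
  using p finite_atLeastAtMost
proof (induction p arbitrary: m rule: permutes_induct)
  case id
  then show ?case by (simp add: comp_def)
next
  case (swap a b p)
  have "f (m \<circ> (transpose a b \<circ> p)) = of_int (sign p) * f (m \<circ> transpose a b)"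
    using swap.IH[of "m \<circ> transpose a b"] by (simp only: comp_assoc)
  also have "f (m \<circ> transpose a b) = of_int (sign (transpose a b)) * f m"
    using alternating_transpose[OF f, of a b m] alternating_transpose[OF f, of b a m] swap
    by (cases a b rule: linorder_cases) (auto simp: sign_swap_id transpose_commute comp_def)
  also have "of_int (sign p) * (of_int (sign (transpose a b)) * f m) = of_int (sign (transpose a b \<circ> p)) * f m"
    by (subst sign_compose) (use swap in \<open>auto simp: permutation_swap_id intro: permutes_imp_permutation[of "{1..n}"]\<close>)
  finally show ?case .
qed

lemma alternating_asch: "alternating n (asch n X)"
  by (simp add: alternating_def alt_asch)

text \<open>Both existence and uniqueness are needed to evaluate the definite description in
  \<open>ext_schur\<close>.\<close>

lemma sorting_permutation_unique:
  fixes g :: "nat \<Rightarrow> int"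
  assumes g: "inj_on g {1..n}"
  shows "\<exists>!\<sigma>. \<sigma> permutes {1..n} \<and> (\<forall>i j. 1 \<le> i \<and> i < j \<and> j \<le> n \<longrightarrow> g (\<sigma> i) > g (\<sigma> j))"
proof -
  \<comment> \<open>The rank of an index is the inverse of the sorting permutation.\<close>
  define r where "r j = (if j \<in> {1..n} then card {i\<in>{1..n}. g i \<ge> g j} else j)" for j
  have less: "r i < r j \<longleftrightarrow> g j < g i" if ij: "i \<in> {1..n}" "j \<in> {1..n}" for i j
  proof -
    have *: "r i < r j" if "g j < g i" "i \<in> {1..n}" "j \<in> {1..n}" for i j
    proof -
      have "{k\<in>{1..n}. g k \<ge> g i} \<subset> {k\<in>{1..n}. g k \<ge> g j}"
        using that by (intro psubsetI notI) (auto dest!: eqset_imp_iff[of _ _ j])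
      then show ?thesis using that by (simp add: r_def psubset_card_mono)
    qed
    show ?thesis
      using *[of j i] *[of i j] ij inj_onD[OF g, of i j] by (cases "g i" "g j" rule: linorder_cases) auto
  qed
  have into: "r j \<in> {1..n}" if "j \<in> {1..n}" for j
  proof -
    have "card {i\<in>{1..n}. g i \<ge> g j} \<le> card {1..n}" by (rule card_mono) auto
    moreover have "card {i\<in>{1..n}. g i \<ge> g j} > 0" using that by (auto simp: card_gt_0_iff)
    ultimately show ?thesis using that by (simp add: r_def)
  qed
  have inj: "inj_on r {1..n}"
  proof (rule inj_onI)
    fix i j assume ij: "i \<in> {1..n}" "j \<in> {1..n}" and "r i = r j"
    then have "g i = g j" using less[of i j] less[of j i] by (cases "g i" "g j" rule: linorder_cases) auto
    then show "i = j" using inj_onD[OF g] ij by blast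
  qed
  moreover have "r ` {1..n} = {1..n}"
    by (rule endo_inj_surj[OF finite_atLeastAtMost _ inj]) (use into in blast)
  ultimately have "bij_betw r {1..n} {1..n}" by (simp add: bij_betw_def)
  then have r: "r permutes {1..n}" by (rule bij_imp_permutes) (auto simp: r_def)
  show ?thesis
  proof (rule ex1I[of _ "inv r"], intro conjI allI impI)
    show "inv r permutes {1..n}" using r by (rule permutes_inv)
    fix i j :: nat assume ij: "1 \<le> i \<and> i < j \<and> j \<le> n"
    then have "inv r i \<in> {1..n}" "inv r j \<in> {1..n}"
      using permutes_in_image[OF permutes_inv[OF r], of i] permutes_in_image[OF permutes_inv[OF r], of j] by simp_all
    then show "g (inv r i) > g (inv r j)"
      using less[of "inv r i" "inv r j"] ij permutes_inverses(1)[OF r] by simp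
  next
    fix \<sigma> assume \<sigma>: "\<sigma> permutes {1..n} \<and> (\<forall>i j. 1 \<le> i \<and> i < j \<and> j \<le> n \<longrightarrow> g (\<sigma> i) > g (\<sigma> j))"
    then have img: "\<sigma> ` {1..n} = {1..n}" by (auto simp: permutes_image)
    have dec: "g (\<sigma> j) < g (\<sigma> i)" if "i \<in> {1..n}" "j \<in> {1..n}" "i < j" for i j
      using \<sigma> that by auto
    have "r (\<sigma> i) = i" for i
    proof (cases "i \<in> {1..n}")
      case True
      have anti: "g (\<sigma> j) \<ge> g (\<sigma> i) \<longleftrightarrow> j \<le> i" if "j \<in> {1..n}" for j
        using dec[OF True that] dec[OF that True] by (cases i j rule: linorder_cases) auto
      have "{j\<in>{1..n}. g j \<ge> g (\<sigma> i)} = {j\<in>\<sigma> ` {1..n}. g j \<ge> g (\<sigma> i)}"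
        by (simp only: img)
      also have "\<dots> = \<sigma> ` {j\<in>{1..n}. g (\<sigma> j) \<ge> g (\<sigma> i)}"
        by (rule Compr_image_eq)
      also have "{j\<in>{1..n}. g (\<sigma> j) \<ge> g (\<sigma> i)} = {1..i}"
        using anti True by auto
      finally have "card {j\<in>{1..n}. g j \<ge> g (\<sigma> i)} = i"
        using \<sigma> by (simp add: card_image permutes_inj_on[of \<sigma> "{1..n}"])
      moreover have "\<sigma> i \<in> {1..n}" using img True by blast
      ultimately show ?thesis by (simp only: r_def if_True)
    next
      case False
      then show ?thesis using \<sigma> permutes_not_in[of \<sigma> "{1..n}" i] by (auto simp: r_def)
    qed
    then have "\<sigma> i = inv r i" for i
      using permutes_inverses(2)[OF r, of "\<sigma> i"] by simp
    then show "\<sigma> = inv r" by (rule ext)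
  qed
qed

subsection \<open>The branching rule for Schur polynomials\<close>

lemma yd_cells_Sigma: "yd_cells n mu = (SIGMA a:{1..n}. {1..mu a})"
  by (auto simp: yd_cells_def)

lemma finite_yd_cells: "finite (yd_cells n mu)"
  by (simp add: yd_cells_Sigma)

lemma card_yd_cells: "card (yd_cells n mu) = (\<Sum>i\<in>{1..n}. mu i)"
  by (simp add: yd_cells_Sigma)

definition interlacing :: "nat \<Rightarrow> (nat \<Rightarrow> nat) \<Rightarrow> (nat \<Rightarrow> nat) set" where
  "interlacing d mu = {nu. (\<forall>i\<in>{1..d}. mu (Suc i) \<le> nu i \<and> nu i \<le> mu i) \<and> (\<forall>i. i \<notin> {1..d} \<longrightarrow> nu i = 0)}"

lemma yd_cells_interlacing:
  assumes "nu \<in> interlacing d mu" shows "yd_cells d nu \<subseteq> yd_cells (Suc d) mu"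
proof
  fix x assume "x \<in> yd_cells d nu"
  moreover from this have "nu (fst x) \<le> mu (fst x)"
    using assms by (auto simp: yd_cells_def interlacing_def)
  ultimately show "x \<in> yd_cells (Suc d) mu" by (auto simp: yd_cells_def)
qed

text \<open>This undoes the removal of all entries d+1 from a tableau; \<open>shape_below\<close>
  and \<open>truncate\<close> recover the remaining shape and filling.\<close>

definition fill :: "nat \<Rightarrow> (nat \<Rightarrow> nat) \<Rightarrow> (nat \<Rightarrow> nat) \<Rightarrow> (nat \<Rightarrow> nat \<Rightarrow> nat) \<Rightarrow> nat \<Rightarrow> nat \<Rightarrow> nat" where
  "fill d mu nu T = (\<lambda>a b. if (a, b) \<in> yd_cells d nu then T a b else if (a, b) \<in> yd_cells (Suc d) mu then Suc d else 0)"

definition shape_below :: "nat \<Rightarrow> (nat \<Rightarrow> nat) \<Rightarrow> (nat \<Rightarrow> nat \<Rightarrow> nat) \<Rightarrow> nat \<Rightarrow> nat" where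
  "shape_below d mu T = (\<lambda>a. if a \<in> {1..d} then card {b\<in>{1..mu a}. T a b \<le> d} else 0)"

definition truncate :: "nat \<Rightarrow> (nat \<Rightarrow> nat \<Rightarrow> nat) \<Rightarrow> nat \<Rightarrow> nat \<Rightarrow> nat" where
  "truncate d T = (\<lambda>a b. if T a b \<le> d then T a b else 0)"

lemma ssytD:
  assumes "T \<in> ssyt n mu"
  shows "(a, b) \<notin> yd_cells n mu \<Longrightarrow> T a b = 0"
    and "(a, b) \<in> yd_cells n mu \<Longrightarrow> 1 \<le> T a b \<and> T a b \<le> n"
    and "(a, b) \<in> yd_cells n mu \<Longrightarrow> (a, b + 1) \<in> yd_cells n mu \<Longrightarrow> T a b \<le> T a (b + 1)"
    and "(a, b) \<in> yd_cells n mu \<Longrightarrow> (a + 1, b) \<in> yd_cells n mu \<Longrightarrow> T a b < T (a + 1) b"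
  using assms unfolding ssyt_def by blast+

lemma fill_in_ssyt:
  assumes nu: "nu \<in> interlacing d mu" and T: "T \<in> ssyt d nu"
  shows "fill d mu nu T \<in> ssyt (Suc d) mu"
  unfolding ssyt_def mem_Collect_eq
proof (intro conjI allI impI, goal_cases)
  case (1 a b)
  then show ?case using yd_cells_interlacing[OF nu] by (auto simp: fill_def)
next
  case (2 a b)
  then show ?case using ssytD(2)[OF T, of a b] by (auto simp: fill_def)
next
  case (3 a b)
  then show ?case using ssytD(2)[OF T, of a b] by (auto simp: fill_def)
next
  case (4 a b)
  then have "(a, b) \<in> yd_cells d nu" if "(a, b + 1) \<in> yd_cells d nu"
    using that by (auto simp: yd_cells_def)
  then show ?case using 4 ssytD(2)[OF T, of a b] ssytD(3)[OF T, of a b] by (auto simp: fill_def)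
next
  case (5 a b)
  then have "(a, b) \<in> yd_cells d nu"
    using nu by (force simp: yd_cells_def interlacing_def)
  then show ?case using 5 ssytD(2)[OF T, of a b] ssytD(4)[OF T, of a b] by (auto simp: fill_def)
qed

lemma shape_below_fill:
  assumes nu: "nu \<in> interlacing d mu" and T: "T \<in> ssyt d nu"
  shows "shape_below d mu (fill d mu nu T) = nu"
proof
  fix a
  show "shape_below d mu (fill d mu nu T) a = nu a"
  proof (cases "a \<in> {1..d}")
    case True
    then have "nu a \<le> mu a" using nu by (auto simp: interlacing_def)
    then have "{b\<in>{1..mu a}. fill d mu nu T a b \<le> d} = {1..nu a}"
      using True ssytD(2)[OF T, of a] by (auto simp: fill_def yd_cells_def)
    then show ?thesis using True by (simp add: shape_below_def)
  qed (use nu in \<open>auto simp: shape_below_def interlacing_def\<close>)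
qed

lemma truncate_fill:
  assumes "T \<in> ssyt d nu"
  shows "truncate d (fill d mu nu T) = T"
  using ssytD(1,2)[OF assms] by (auto simp: truncate_def fill_def fun_eq_iff)

text \<open>Rows increase weakly, so entries at most d form an initial segment of each row. Columns
  increase strictly, so row a has entries at least a, leaving only d+1 in row d+1, and an entry
  above another cell is at most d; the latter gives interlacing.\<close>

lemma ssyt_Suc_cases:
  assumes mu: "\<forall>i\<in>{1..d}. mu (Suc i) \<le> mu i" and T: "T \<in> ssyt (Suc d) mu"
  shows "shape_below d mu T \<in> interlacing d mu" (is ?A)
    and "truncate d T \<in> ssyt d (shape_below d mu T)" (is ?B)
    and "fill d mu (shape_below d mu T) (truncate d T) = T" (is ?C)
proof -
  let ?nu = "shape_below d mu T"
  have ge: "a \<le> T a b" if "(a, b) \<in> yd_cells (Suc d) mu" for a b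
    using that
  proof (induction a)
    case (Suc a)
    show ?case
    proof (cases "a = 0")
      case False
      moreover from this have "mu (Suc a) \<le> mu a" using Suc.prems mu by (auto simp: yd_cells_def)
      ultimately have "(a, b) \<in> yd_cells (Suc d) mu" using Suc.prems by (auto simp: yd_cells_def)
      then show ?thesis using Suc ssytD(4)[OF T, of a b] by auto
    qed (use ssytD(2)[OF T Suc.prems] in auto)
  qed simp
  have mono: "T a b \<le> T a c" if "(a, c) \<in> yd_cells (Suc d) mu" "1 \<le> b" "b \<le> c" for a b c
    using that(3,1)
  proof (induction c rule: dec_induct)
    case (step c)
    then have "(a, c) \<in> yd_cells (Suc d) mu" using that(2) by (auto simp: yd_cells_def)
    then show ?case using step ssytD(3)[OF T, of a c] by auto
  qed simp
  have le_iff: "T a b \<le> d \<longleftrightarrow> b \<le> ?nu a" if ab: "(a, b) \<in> yd_cells (Suc d) mu" "a \<le> d" for a b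
  proof -
    let ?S = "{b\<in>{1..mu a}. T a b \<le> d}"
    have a: "a \<in> {1..d}" using ab by (auto simp: yd_cells_def)
    have S: "?S = {1..card ?S}"
    proof (cases "?S = {}")
      case False
      have fin: "finite ?S" by simp
      define m where "m = Max ?S"
      have m: "m \<in> ?S" unfolding m_def using Max_in[OF fin False] .
      have "?S = {1..m}"
      proof (intro equalityI subsetI)
        fix b assume "b \<in> ?S" then show "b \<in> {1..m}" using Max_ge[OF fin] by (auto simp: m_def)
      next
        fix b assume b: "b \<in> {1..m}"
        have "(a, m) \<in> yd_cells (Suc d) mu" using m a by (auto simp: yd_cells_def)
        from mono[OF this, of b] show "b \<in> ?S" using b m by auto
      qed
      then show ?thesis by simp
    qed simp
    have "b \<in> {1..mu a}" using ab by (auto simp: yd_cells_def)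
    moreover have "?nu a = card ?S" using a by (simp add: shape_below_def)
    ultimately show ?thesis using eqset_imp_iff[OF S, of b] by auto
  qed
  have nu_le: "?nu a \<le> mu a" if "a \<in> {1..d}" for a
  proof -
    have "card {b\<in>{1..mu a}. T a b \<le> d} \<le> card {1..mu a}" by (rule card_mono) auto
    then show ?thesis using that by (simp add: shape_below_def)
  qed
  have cells: "(a, b) \<in> yd_cells d ?nu \<longleftrightarrow> (a, b) \<in> yd_cells (Suc d) mu \<and> T a b \<le> d" for a b
  proof
    assume ab: "(a, b) \<in> yd_cells d ?nu"
    then have "a \<in> {1..d}" by (auto simp: yd_cells_def)
    then have "?nu a \<le> mu a" by (rule nu_le)
    then have "(a, b) \<in> yd_cells (Suc d) mu" using ab by (auto simp: yd_cells_def)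
    then show "(a, b) \<in> yd_cells (Suc d) mu \<and> T a b \<le> d"
      using le_iff ab by (auto simp: yd_cells_def)
  next
    assume ab: "(a, b) \<in> yd_cells (Suc d) mu \<and> T a b \<le> d"
    then have "a \<le> d" using ge[of a b] by simp
    then show "(a, b) \<in> yd_cells d ?nu" using le_iff[of a b] ab by (auto simp: yd_cells_def)
  qed
  show ?A
    unfolding interlacing_def mem_Collect_eq
  proof (intro conjI ballI allI impI)
    fix i assume i: "i \<in> {1..d}"
    show "?nu i \<le> mu i"
      by (rule nu_le[OF i])
    show "mu (Suc i) \<le> ?nu i"
    proof (cases "mu (Suc i) = 0")
      case False
      let ?b = "mu (Suc i)"
      have c: "(i, ?b) \<in> yd_cells (Suc d) mu" "(i + 1, ?b) \<in> yd_cells (Suc d) mu"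
        using False i mu by (auto simp: yd_cells_def)
      then have "T i ?b \<le> d" using ssytD(4)[OF T c] ssytD(2)[OF T c(2)] by simp
      then show ?thesis using le_iff[OF c(1)] i by auto
    qed simp
  qed (auto simp: shape_below_def)
  show ?B
    unfolding ssyt_def mem_Collect_eq cells truncate_def
    using ssytD[OF T] by auto
  show ?C
  proof (intro ext)
    fix a b
    show "fill d mu ?nu (truncate d T) a b = T a b"
      using ssytD(1,2)[OF T, of a b] by (auto simp: fill_def cells truncate_def)
  qed
qed

lemma ssyt_Suc:
  assumes "\<forall>i\<in>{1..d}. mu (Suc i) \<le> mu i"
  shows "ssyt (Suc d) mu = (\<lambda>(nu, T). fill d mu nu T) ` (SIGMA nu:interlacing d mu. ssyt d nu)"
proof (intro equalityI subsetI)
  fix T assume "T \<in> ssyt (Suc d) mu"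
  from ssyt_Suc_cases[OF assms this] show "T \<in> (\<lambda>(nu, T). fill d mu nu T) ` (SIGMA nu:interlacing d mu. ssyt d nu)"
    by (intro image_eqI[of _ _ "(shape_below d mu T, truncate d T)"]) auto
qed (auto intro: fill_in_ssyt)

lemma finite_interlacing: "finite (interlacing d mu)"
proof -
  have "finite {f. \<forall>i. (i \<in> {1..d} \<longrightarrow> f i \<in> (\<Union>i\<in>{1..d}. {..mu i})) \<and> (i \<notin> {1..d} \<longrightarrow> f i = 0)}"
    by (rule finite_set_of_finite_funs) auto
  moreover have "interlacing d mu \<subseteq> {f. \<forall>i. (i \<in> {1..d} \<longrightarrow> f i \<in> (\<Union>i\<in>{1..d}. {..mu i})) \<and> (i \<notin> {1..d} \<longrightarrow> f i = 0)}"
    unfolding interlacing_def by fastforce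
  ultimately show ?thesis by (rule rev_finite_subset)
qed

lemma interlacing_decreasing:
  "nu \<in> interlacing d mu \<Longrightarrow> \<forall>i\<in>{1..<d}. nu (Suc i) \<le> nu i"
proof
  fix i assume nu: "nu \<in> interlacing d mu" and i: "i \<in> {1..<d}"
  then have "nu (Suc i) \<le> mu (Suc i)" "mu (Suc i) \<le> nu i" by (auto simp: interlacing_def)
  then show "nu (Suc i) \<le> nu i" by (rule order_trans)
qed

lemma finite_ssyt:
  assumes "\<forall>i\<in>{1..<n}. mu (Suc i) \<le> mu i" shows "finite (ssyt n mu)"
  using assms
proof (induction n arbitrary: mu)
  case 0
  have "ssyt 0 mu \<subseteq> {\<lambda>_ _. 0}" by (auto simp: ssyt_def yd_cells_def fun_eq_iff)
  then show ?case by (rule finite_subset) simp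
next
  case (Suc d)
  then have "\<forall>i\<in>{1..d}. mu (Suc i) \<le> mu i" by auto
  then show ?case
    using Suc.IH interlacing_decreasing by (subst ssyt_Suc) (auto intro!: finite_imageI finite_SigmaI finite_interlacing)
qed

lemma schur_Suc:
  fixes X :: "nat \<Rightarrow> 'a::comm_ring_1"
  assumes mu: "\<forall>i\<in>{1..d}. mu (Suc i) \<le> mu i"
  shows "schur (Suc d) mu X = (\<Sum>nu\<in>interlacing d mu. schur d nu X * X (Suc d) ^ ((\<Sum>i\<in>{1..Suc d}. mu i) - (\<Sum>i\<in>{1..d}. nu i)))"
proof -
  have inj: "inj_on (\<lambda>(nu, T). fill d mu nu T) (SIGMA nu:interlacing d mu. ssyt d nu)"
    by (rule inj_on_inverseI[of _ "\<lambda>T. (shape_below d mu T, truncate d T)"])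
      (auto simp: shape_below_fill truncate_fill)
  have w: "(\<Prod>(a,b)\<in>yd_cells (Suc d) mu. X (fill d mu nu T a b)) =
      (\<Prod>(a,b)\<in>yd_cells d nu. X (T a b)) * X (Suc d) ^ ((\<Sum>i\<in>{1..Suc d}. mu i) - (\<Sum>i\<in>{1..d}. nu i))"
    if nu: "nu \<in> interlacing d mu" for nu T
  proof -
    let ?D = "yd_cells (Suc d) mu - yd_cells d nu"
    note sub = yd_cells_interlacing[OF nu]
    have "(\<Prod>(a,b)\<in>yd_cells (Suc d) mu. X (fill d mu nu T a b)) =
       (\<Prod>(a,b)\<in>?D. X (fill d mu nu T a b)) * (\<Prod>(a,b)\<in>yd_cells d nu. X (fill d mu nu T a b))"
      by (rule prod.subset_diff[OF sub finite_yd_cells])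
    also have "(\<Prod>(a,b)\<in>?D. X (fill d mu nu T a b)) = (\<Prod>x\<in>?D. X (Suc d))"
      by (rule prod.cong) (auto simp: fill_def)
    also have "\<dots> = X (Suc d) ^ ((\<Sum>i\<in>{1..Suc d}. mu i) - (\<Sum>i\<in>{1..d}. nu i))"
      by (simp add: card_Diff_subset[OF finite_yd_cells sub] card_yd_cells)
    also have "(\<Prod>(a,b)\<in>yd_cells d nu. X (fill d mu nu T a b)) = (\<Prod>(a,b)\<in>yd_cells d nu. X (T a b))"
      by (rule prod.cong) (auto simp: fill_def)
    finally show ?thesis by (simp only: mult.commute)
  qed
  have "schur (Suc d) mu X = (\<Sum>(nu, T)\<in>(SIGMA nu:interlacing d mu. ssyt d nu). \<Prod>(a,b)\<in>yd_cells (Suc d) mu. X (fill d mu nu T a b))"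
    unfolding schur_def ssyt_Suc[OF mu] by (subst sum.reindex[OF inj]) (simp add: case_prod_unfold)
  also have "\<dots> = (\<Sum>nu\<in>interlacing d mu. \<Sum>T\<in>ssyt d nu. \<Prod>(a,b)\<in>yd_cells (Suc d) mu. X (fill d mu nu T a b))"
    using interlacing_decreasing by (subst sum.Sigma) (auto simp: finite_interlacing intro!: finite_ssyt)
  finally show ?thesis by (simp add: w schur_def sum_distrib_right)
qed

subsection \<open>Identification with Schur polynomials\<close>

text \<open>At these parameters \<open>opR\<close> with indices p, q is \<open>shi q\<close>, and q
  is the larger index of q-1 pairs.\<close>

lemma act_opR_prod_010:
  "act (opR_prod 0 1 0 n) f m = f (\<lambda>i. if i \<in> {1..n} then m i - int (i - 1) else m i)"
proof (induction n arbitrary: f m)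
  case 0
  have "pairs 0 = {}" by (auto simp: pairs_def)
  then show ?case by (simp add: opR_prod_def)
next
  case (Suc n)
  have R: "opR 0 1 0 p q = (shi q :: 'a laurent)" for p q
    by (simp add: opR_def cst_def)
  have pow: "act (shi q ^ c) f m = f (m(q := m q - int c))" for q c f and m :: "nat \<Rightarrow> int"
  proof (induction c arbitrary: m)
    case (Suc c)
    have "act (shi q ^ Suc c) f m = f ((m(q := m q - 1))(q := (m(q := m q - 1)) q - int c))"
      unfolding power_Suc act_mult act_shi Suc.IH ..
    also have "(m(q := m q - 1))(q := (m(q := m q - 1)) q - int c) = m(q := m q - int (Suc c))"
      by (auto simp: fun_eq_iff)
    finally show ?case .
  qed simp
  have pairs: "pairs (Suc n) = pairs n \<union> (\<lambda>p. (p, Suc n)) ` {1..n}"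
    by (auto simp: pairs_def image_iff)
  have "(opR_prod 0 1 0 (Suc n) :: 'a laurent) = opR_prod 0 1 0 n * (\<Prod>(p,q)\<in>(\<lambda>p. (p, Suc n)) ` {1..n}. shi q)"
    unfolding opR_prod_def pairs R
    by (rule prod.union_disjoint) (auto simp: pairs_def intro: finite_subset[OF _ finite_pairs])
  also have "(\<Prod>(p,q)\<in>(\<lambda>p. (p, Suc n)) ` {1..n}. shi q) = (shi (Suc n) ^ n :: 'a laurent)"
    by (subst prod.reindex) (auto simp: inj_on_def)
  finally have "act (opR_prod 0 1 0 (Suc n)) f m =
      f ((\<lambda>i. if i \<in> {1..n} then m i - int (i - 1) else m i)(Suc n := m (Suc n) - int n))"
    by (simp only: act_mult Suc.IH pow) simp
  also have "(\<lambda>i. if i \<in> {1..n} then m i - int (i - 1) else m i)(Suc n := m (Suc n) - int n) =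
      (\<lambda>i. if i \<in> {1..Suc n} then m i - int (i - 1) else m i)"
    by (auto simp: fun_eq_iff)
  finally show ?case .
qed

lemma opsch_010: "opsch 0 1 0 n X k = asch n X (\<lambda>i. k i + 1)"
  unfolding opsch_def act_opR_prod_010
  by (rule local_asch[unfolded local_def, rule_format]) auto

definition weak_rows :: "nat \<Rightarrow> (nat \<Rightarrow> int) \<Rightarrow> (nat \<Rightarrow> int) set" where
  "weak_rows d k = {l. (\<forall>i\<in>{1..d}. k i \<le> l i \<and> l i \<le> k (Suc i)) \<and> (\<forall>i. i \<notin> {1..d} \<longrightarrow> l i = 0)}"

text \<open>At u = w = 0, v = 1 a right-leaning entry has weight 0 and any other has weight 1/\<xi>.
  In the rows that count, \<open>l i < k (Suc i)\<close>, so strictness is automatic, and undoing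
  the shift by i-1 leaves weak interlacing.\<close>

lemma asch_Suc_branching:
  fixes X :: "nat \<Rightarrow> 'a::field"
  assumes \<kappa>: "\<forall>i\<in>{1..d}. \<kappa> i \<le> \<kappa> (Suc i)" and X: "X (Suc d) \<noteq> 0"
  shows "asch (Suc d) X (\<lambda>i. \<kappa> i + int i) =
     (\<Sum>l\<in>weak_rows d \<kappa>. X (Suc d) powi ((\<Sum>i\<in>{1..Suc d}. \<kappa> i) - (\<Sum>i\<in>{1..d}. l i)) * asch d X (\<lambda>i. l i + int i))"
proof -
  \<comment> \<open>\<open>opsch_010\<close> evaluates \<open>asch\<close> at
    \<open>k i + 1\<close>, which has to be the given point.\<close>
  define k where "k i = \<kappa> i + int i - 1" for i
  let ?\<xi> = "X (Suc d)"
  let ?t = "\<lambda>l. ?\<xi> powi ((\<Sum>i\<in>{1..Suc d}. k i) - (\<Sum>i\<in>{1..d}. l i)) *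
     (\<Prod>i\<in>{1..d}. step_wt 0 1 0 ?\<xi> (k i) (k (Suc i)) (l i)) * asch d X (\<lambda>i. l i + 1)"
  let ?R = "{l \<in> strict_rows d k. \<forall>i\<in>{1..d}. l i < k (Suc i)}"
  have k: "\<forall>i\<in>{1..d}. k i < k (Suc i)" using \<kappa> by (auto simp: k_def)
  have "asch (Suc d) X (\<lambda>i. \<kappa> i + int i) = opsch 0 1 0 (Suc d) X k"
    unfolding opsch_010 k_def by simp
  also have "\<dots> = (\<Sum>l\<in>strict_rows d k. ?t l)"
    unfolding opsch_Suc[where d = d and k = k and X = X, OF k X] opsch_010 ..
  also have "\<dots> = (\<Sum>l\<in>?R. ?t l)"
  proof (rule sum.mono_neutral_right[OF finite_strict_rows])
    show "\<forall>l\<in>strict_rows d k - ?R. ?t l = 0"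
    proof
      fix l assume l: "l \<in> strict_rows d k - ?R"
      then obtain i where i: "i \<in> {1..d}" "\<not> l i < k (Suc i)" by auto
      moreover have "l i \<le> k (Suc i)" using l i(1) unfolding strict_rows_def by blast
      ultimately have "l i = k (Suc i)" by simp
      moreover have "k i < k (Suc i)" using k i by blast
      ultimately have "step_wt 0 1 0 ?\<xi> (k i) (k (Suc i)) (l i) = 0" by (simp add: step_wt_def)
      then have "(\<Prod>i\<in>{1..d}. step_wt 0 1 0 ?\<xi> (k i) (k (Suc i)) (l i)) = 0"
        using i by (intro prod_zero) auto
      then show "?t l = 0" by simp
    qed
  qed auto
  also have "\<dots> = (\<Sum>l\<in>weak_rows d \<kappa>. ?\<xi> powi ((\<Sum>i\<in>{1..Suc d}. \<kappa> i) - (\<Sum>i\<in>{1..d}. l i)) * asch d X (\<lambda>i. l i + int i))"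
  proof (rule sum.reindex_bij_witness[of _ "\<lambda>l i. if i \<in> {1..d} then l i + int i - 1 else 0"
        "\<lambda>l i. if i \<in> {1..d} then l i - int i + 1 else 0"], goal_cases)
    case (1 l)
    then show ?case by (auto simp: strict_rows_def fun_eq_iff)
  next
    case (2 l)
    then have "k i \<le> l i \<and> l i < k (Suc i)" if "i \<in> {1..d}" for i
      using that by (auto simp: strict_rows_def)
    note b = this
    have "\<kappa> i \<le> l i - int i + 1 \<and> l i - int i + 1 \<le> \<kappa> (Suc i)" if "i \<in> {1..d}" for i
      using b[OF that] unfolding k_def by auto
    then show ?case by (simp add: weak_rows_def)
  next
    case (3 l)
    then show ?case by (auto simp: weak_rows_def fun_eq_iff)
  next
    case (4 l)
    let ?l = "\<lambda>i. if i \<in> {1..d} then l i + int i - 1 else 0"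
    have l: "\<kappa> i \<le> l i \<and> l i \<le> \<kappa> (Suc i)" if "i \<in> {1..d}" for i
      using 4 that by (auto simp: weak_rows_def)
    have b: "k i \<le> ?l i \<and> ?l i < k (Suc i)" if "i \<in> {1..d}" for i
      using l[OF that] that by (auto simp: k_def)
    have "?l i < ?l (Suc i)" if "i \<in> {1..<d}" for i
      using b[of i] b[of "Suc i"] that by auto
    then show ?case using b unfolding strict_rows_def by (auto simp: less_imp_le)
  next
    case (5 l)
    let ?l = "\<lambda>i. if i \<in> {1..d} then l i - int i + 1 else 0"
    have b: "k i \<le> l i \<and> l i < k (Suc i)" if "i \<in> {1..d}" for i
      using 5 that by (auto simp: strict_rows_def)
    have "(\<Prod>i\<in>{1..d}. step_wt 0 1 0 ?\<xi> (k i) (k (Suc i)) (l i)) = (\<Prod>i\<in>{1..d}. inverse ?\<xi>)"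
    proof (rule prod.cong[OF refl])
      fix i assume "i \<in> {1..d}"
      from b[OF this] show "step_wt 0 1 0 ?\<xi> (k i) (k (Suc i)) (l i) = inverse ?\<xi>"
        by (simp add: step_wt_def)
    qed
    then have p: "(\<Prod>i\<in>{1..d}. step_wt 0 1 0 ?\<xi> (k i) (k (Suc i)) (l i)) = ?\<xi> powi (- int d)"
      by (simp add: power_int_minus power_inverse)
    have "(\<Sum>i\<in>{1..Suc d}. k i) = (\<Sum>i\<in>{1..Suc d}. \<kappa> i) + (\<Sum>i\<in>{1..Suc d}. int i - 1)"
      unfolding k_def sum.distrib[symmetric] by (simp add: algebra_simps)
    moreover have "(\<Sum>i\<in>{1..d}. l i) = (\<Sum>i\<in>{1..d}. ?l i) + (\<Sum>i\<in>{1..d}. int i - 1)"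
      unfolding sum.distrib[symmetric] by (rule sum.cong) auto
    moreover have "(\<Sum>i\<in>{1..Suc d}. int i - 1) = (\<Sum>i\<in>{1..d}. int i - 1) + int d" by simp
    ultimately have e: "(\<Sum>i\<in>{1..Suc d}. k i) - (\<Sum>i\<in>{1..d}. l i) + - int d = (\<Sum>i\<in>{1..Suc d}. \<kappa> i) - (\<Sum>i\<in>{1..d}. ?l i)"
      by linarith
    have "asch d X (\<lambda>i. l i + 1) = asch d X (\<lambda>i. ?l i + int i)"
      by (rule local_asch[unfolded local_def, rule_format]) auto
    moreover have "?\<xi> powi ((\<Sum>i\<in>{1..Suc d}. k i) - (\<Sum>i\<in>{1..d}. l i)) * ?\<xi> powi (- int d) =
       ?\<xi> powi ((\<Sum>i\<in>{1..Suc d}. \<kappa> i) - (\<Sum>i\<in>{1..d}. ?l i))"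
      unfolding e[symmetric] by (rule power_int_add[symmetric]) (use X in simp)
    ultimately show ?case unfolding p by simp
  qed
  finally show ?thesis .
qed

lemma sum_rev: "(\<Sum>i\<in>{1..n}. f (Suc n - i)) = (\<Sum>i\<in>{1..n}. f i)"
  by (rule sum.reindex_bij_witness[of _ "\<lambda>i. Suc n - i" "\<lambda>i. Suc n - i"]) auto

text \<open>Both sides obey the same branching rule, with the parts of \<open>mu\<close> reversed
  against \<kappa>. Adding p to all parts raises the exponent of the last variable by p, which the
  factor \<open>X (Suc d) powi (- int p)\<close> compensates.\<close>

lemma asch_eq_schur:
  fixes X :: "nat \<Rightarrow> 'a::field"
  assumes "\<forall>i\<in>{1..<n}. \<kappa> i \<le> \<kappa> (Suc i)" "\<forall>i\<in>{1..n}. 0 \<le> \<kappa> i + int p" "\<forall>i\<in>{1..n}. X i \<noteq> 0"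
    and "\<And>i. i \<in> {1..n} \<Longrightarrow> int (mu i) = \<kappa> (Suc n - i) + int p"
  shows "asch n X (\<lambda>i. \<kappa> i + int i) = schur n mu X * (\<Prod>i=1..n. X i powi (- int p))"
  using assms
proof (induction n arbitrary: \<kappa> mu)
  case 0
  have "ssyt 0 mu = {\<lambda>_ _. 0}" by (auto simp: ssyt_def yd_cells_def fun_eq_iff)
  then show ?case by (simp add: schur_def yd_cells_Sigma)
next
  case (Suc d)
  let ?\<xi> = "X (Suc d)"
  have \<kappa>: "\<forall>i\<in>{1..d}. \<kappa> i \<le> \<kappa> (Suc i)" and \<xi>: "?\<xi> \<noteq> 0" using Suc.prems by auto
  have mu: "int (mu i) = \<kappa> (Suc (Suc d) - i) + int p" if "i \<in> {1..Suc d}" for i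
    using Suc.prems(4)[OF that] .
  have mu': "\<forall>i\<in>{1..d}. mu (Suc i) \<le> mu i"
  proof
    fix i assume i: "i \<in> {1..d}"
    then have "Suc d - i \<in> {1..d}" by auto
    then have "\<kappa> (Suc d - i) \<le> \<kappa> (Suc (Suc d - i))" using \<kappa> by blast
    then have "int (mu (Suc i)) \<le> int (mu i)" using mu[of i] mu[of "Suc i"] i by (simp add: Suc_diff_le)
    then show "mu (Suc i) \<le> mu i" by simp
  qed
  have smu: "int (\<Sum>i\<in>{1..Suc d}. mu i) = (\<Sum>i\<in>{1..Suc d}. \<kappa> i) + int (Suc d) * int p"
  proof -
    have "int (\<Sum>i\<in>{1..Suc d}. mu i) = (\<Sum>i\<in>{1..Suc d}. \<kappa> (Suc (Suc d) - i) + int p)"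
      unfolding of_nat_sum by (rule sum.cong) (use mu in auto)
    also have "\<dots> = (\<Sum>i\<in>{1..Suc d}. \<kappa> (Suc (Suc d) - i)) + int (Suc d) * int p"
      unfolding sum.distrib by simp
    finally show ?thesis unfolding sum_rev .
  qed
  have "asch (Suc d) X (\<lambda>i. \<kappa> i + int i) =
     (\<Sum>l\<in>weak_rows d \<kappa>. ?\<xi> powi ((\<Sum>i\<in>{1..Suc d}. \<kappa> i) - (\<Sum>i\<in>{1..d}. l i)) * asch d X (\<lambda>i. l i + int i))"
    by (rule asch_Suc_branching[where d = d and \<kappa> = \<kappa> and X = X, OF \<kappa> \<xi>])
  also have "\<dots> = (\<Sum>nu\<in>interlacing d mu. (schur d nu X * ?\<xi> ^ ((\<Sum>i\<in>{1..Suc d}. mu i) - (\<Sum>i\<in>{1..d}. nu i))) * (\<Prod>i=1..Suc d. X i powi (- int p)))"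
  proof (rule sum.reindex_bij_witness[of _ "\<lambda>nu i. if i \<in> {1..d} then int (nu (Suc d - i)) - int p else 0"
        "\<lambda>l i. if i \<in> {1..d} then nat (l (Suc d - i) + int p) else 0"], goal_cases)
    case (1 l)
    have "0 \<le> l i + int p" if "i \<in> {1..d}" for i
    proof -
      have "\<kappa> i \<le> l i" using 1 that unfolding weak_rows_def by blast
      then show ?thesis using bspec[OF Suc.prems(2), of i] that by auto
    qed
    then show ?case using 1 by (auto simp: weak_rows_def fun_eq_iff)
  next
    case (2 l)
    have "mu (Suc i) \<le> nat (l (Suc d - i) + int p) \<and> nat (l (Suc d - i) + int p) \<le> mu i" if i: "i \<in> {1..d}" for i
    proof -
      have "Suc d - i \<in> {1..d}" using i by auto
      then have "\<kappa> (Suc d - i) \<le> l (Suc d - i) \<and> l (Suc d - i) \<le> \<kappa> (Suc (Suc d - i))"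
        using 2 unfolding weak_rows_def by blast
      then show ?thesis using mu[of i] mu[of "Suc i"] i by (auto simp: Suc_diff_le)
    qed
    then show ?case by (simp add: interlacing_def)
  next
    case (3 nu)
    then show ?case by (auto simp: interlacing_def fun_eq_iff)
  next
    case (4 nu)
    have "\<kappa> i \<le> int (nu (Suc d - i)) - int p \<and> int (nu (Suc d - i)) - int p \<le> \<kappa> (Suc i)" if i: "i \<in> {1..d}" for i
    proof -
      have j: "Suc d - i \<in> {1..d}" using i by auto
      then have "mu (Suc (Suc d - i)) \<le> nu (Suc d - i) \<and> nu (Suc d - i) \<le> mu (Suc d - i)"
        using 4 unfolding interlacing_def by blast
      moreover have "Suc (Suc d) - Suc (Suc d - i) = i" "Suc (Suc d) - (Suc d - i) = Suc i" using i by auto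
      ultimately show ?thesis using mu[of "Suc (Suc d - i)"] mu[of "Suc d - i"] j by auto
    qed
    then show ?case by (simp add: weak_rows_def)
  next
    case (5 l)
    let ?nu = "\<lambda>i. if i \<in> {1..d} then nat (l (Suc d - i) + int p) else 0"
    have l: "\<kappa> i \<le> l i" "l i \<le> \<kappa> (Suc i)" if "i \<in> {1..d}" for i
      using 5 that by (auto simp: weak_rows_def)
    have pos: "0 \<le> l i + int p" if "i \<in> {1..d}" for i
      using l(1)[OF that] that bspec[OF Suc.prems(2), of i] by auto
    have nu: "int (?nu i) = l (Suc d - i) + int p" if "i \<in> {1..d}" for i
    proof -
      have "Suc d - i \<in> {1..d}" using that by auto
      then show ?thesis using pos that by simp
    qed
    have inc: "\<forall>i\<in>{1..<d}. l i \<le> l (Suc i)"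
    proof
      fix i assume "i \<in> {1..<d}"
      then show "l i \<le> l (Suc i)" using l(2)[of i] l(1)[of "Suc i"] by auto
    qed
    have IH: "asch d X (\<lambda>i. l i + int i) = schur d ?nu X * (\<Prod>i=1..d. X i powi (- int p))"
      by (rule Suc.IH) (use inc pos nu Suc.prems(3) in auto)
    have snu: "int (\<Sum>i\<in>{1..d}. ?nu i) = (\<Sum>i\<in>{1..d}. l i) + int d * int p"
    proof -
      have "int (\<Sum>i\<in>{1..d}. ?nu i) = (\<Sum>i\<in>{1..d}. l (Suc d - i) + int p)"
        unfolding of_nat_sum by (rule sum.cong) (use nu in auto)
      also have "\<dots> = (\<Sum>i\<in>{1..d}. l (Suc d - i)) + int d * int p"
        unfolding sum.distrib by simp
      finally show ?thesis unfolding sum_rev .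
    qed
    have "(\<Sum>i\<in>{1..d}. ?nu i) \<le> (\<Sum>i\<in>{1..d}. mu i)"
    proof (rule sum_mono)
      fix i assume i: "i \<in> {1..d}"
      then have "l (Suc d - i) \<le> \<kappa> (Suc (Suc d) - i)" using l(2)[of "Suc d - i"] by (auto simp: Suc_diff_le)
      then show "?nu i \<le> mu i" using nu[OF i] mu[of i] i by auto
    qed
    then have le: "(\<Sum>i\<in>{1..d}. ?nu i) \<le> (\<Sum>i\<in>{1..Suc d}. mu i)" by simp
    have "int ((\<Sum>i\<in>{1..Suc d}. mu i) - (\<Sum>i\<in>{1..d}. ?nu i)) = ((\<Sum>i\<in>{1..Suc d}. \<kappa> i) - (\<Sum>i\<in>{1..d}. l i)) + int p"
      using le smu snu by (simp only: of_nat_diff[OF le]) (simp add: algebra_simps)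
    then have "?\<xi> ^ ((\<Sum>i\<in>{1..Suc d}. mu i) - (\<Sum>i\<in>{1..d}. ?nu i)) = ?\<xi> powi (((\<Sum>i\<in>{1..Suc d}. \<kappa> i) - (\<Sum>i\<in>{1..d}. l i)) + int p)"
      by (simp only: power_int_of_nat[symmetric])
    also have "\<dots> = ?\<xi> powi ((\<Sum>i\<in>{1..Suc d}. \<kappa> i) - (\<Sum>i\<in>{1..d}. l i)) * ?\<xi> powi int p"
      by (rule power_int_add) (use \<xi> in simp)
    finally have E: "?\<xi> ^ ((\<Sum>i\<in>{1..Suc d}. mu i) - (\<Sum>i\<in>{1..d}. ?nu i)) * ?\<xi> powi (- int p) = ?\<xi> powi ((\<Sum>i\<in>{1..Suc d}. \<kappa> i) - (\<Sum>i\<in>{1..d}. l i))"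
      using \<xi> by (simp add: power_int_minus)
    have P: "(\<Prod>i=1..Suc d. X i powi (- int p)) = (\<Prod>i=1..d. X i powi (- int p)) * ?\<xi> powi (- int p)" by simp
    show ?case unfolding IH E[symmetric] P by (simp only: mult_ac)
  qed
  also have "\<dots> = schur (Suc d) mu X * (\<Prod>i=1..Suc d. X i powi (- int p))"
    unfolding schur_Suc[OF mu'] sum_distrib_right ..
  finally show ?case .
qed

lemma ext_schur_eq_asch:
  fixes X :: "nat \<Rightarrow> 'a::field"
  assumes X: "\<forall>i. 1 \<le> i \<and> i \<le> n \<longrightarrow> X i \<noteq> 0"
  shows "ext_schur n (\<lambda>i. m (n + 1 - i)) X = asch n X (\<lambda>i. m i + int i)"
proof -
  define x where "x i = m i + int i" for i
  define lam where "lam i = m (n + 1 - i)" for i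
  define g where "g i = lam i - int i" for i
  \<comment> \<open>Up to a constant, \<open>g\<close> is the shifted coordinate at the reversed
    index, so coincidences and sorting in \<open>ext_schur\<close> become those of
    \<open>x\<close>.\<close>
  have g: "g i = x (Suc n - i) - int (Suc n)" if "i \<le> n" for i
    using that by (simp add: g_def lam_def x_def of_nat_diff)
  show ?thesis
  proof (cases "\<exists>i j. 1 \<le> i \<and> i < j \<and> j \<le> n \<and> g i = g j")
    case True
    then obtain i j where ij: "1 \<le> i" "i < j" "j \<le> n" "g i = g j" by blast
    then have "x (Suc n - j) = x (Suc n - i)" using g by simp
    then have "asch n X x = 0"
      by (rule alternating_eq_zero[OF alternating_asch, rotated 3]) (use ij in auto)
    moreover have "ext_schur n lam X = 0"
      using True unfolding ext_schur_def g_def by simp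
    ultimately show ?thesis by (simp add: x_def[abs_def] lam_def[abs_def])
  next
    case False
    then have "g i \<noteq> g j" if "1 \<le> i" "i < j" "j \<le> n" for i j using that by blast
    then have inj: "inj_on g {1..n}"
      by (intro linorder_inj_onI) auto
    define \<sigma> where "\<sigma> = (THE \<sigma>. \<sigma> permutes {1..n} \<and> (\<forall>i j. 1 \<le> i \<and> i < j \<and> j \<le> n \<longrightarrow> g (\<sigma> i) > g (\<sigma> j)))"
    have dec: "g (\<sigma> i) > g (\<sigma> j)" if "1 \<le> i" "i < j" "j \<le> n" for i j
      using theI'[OF sorting_permutation_unique[OF inj]] that unfolding \<sigma>_def by blast
    have \<sigma>: "\<sigma> permutes {1..n}"
      using theI'[OF sorting_permutation_unique[OF inj]] unfolding \<sigma>_def by blast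
    define p where "p = nat (- (g (\<sigma> n) + int n))"
    define mu where "mu i = nat (g (\<sigma> i) + int i + int p)" for i
    have ext: "ext_schur n lam X = of_int (sign \<sigma>) * schur n mu X * (\<Prod>i=1..n. X i powi (- int p))"
    proof -
      have a: "lam i + int j - int i = g i + int j" for i j by (simp add: g_def)
      show ?thesis
        unfolding ext_schur_def a g_def[symmetric] if_not_P[OF False] Let_def
          \<sigma>_def[symmetric] p_def[symmetric] mu_def[abs_def] ..
    qed
    define rv where "rv i = (if i \<in> {1..n} then Suc n - i else i)" for i
    have rv: "rv permutes {1..n}"
      by (rule bij_imp_permutes, rule bij_betw_byWitness[of _ rv]) (auto simp: rv_def)
    \<comment> \<open>Sorting \<open>g\<close> downwards means sorting \<open>x\<close> upwards
      after reversing indices on both sides; conjugation by the reversal keeps the sign.\<close>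
    define \<rho> where "\<rho> = rv \<circ> (\<sigma> \<circ> rv)"
    have perm: "permutation rv" "permutation \<sigma>"
      using rv \<sigma> by (auto intro: permutes_imp_permutation[OF finite_atLeastAtMost])
    have \<rho>: "\<rho> permutes {1..n}"
      unfolding \<rho>_def by (intro permutes_compose rv \<sigma>)
    have sgn: "sign \<rho> = sign \<sigma>"
      unfolding \<rho>_def using perm by (simp add: sign_compose permutation_compose)
    have \<sigma>in: "\<sigma> i \<in> {1..n}" if "i \<in> {1..n}" for i
      using permutes_in_image[OF \<sigma>, of i] that by blast
    define \<kappa> where "\<kappa> i = x (\<rho> i) - int i" for i
    have x\<rho>: "x (\<rho> i) = g (\<sigma> (Suc n - i)) + int (Suc n)" if i: "i \<in> {1..n}" for i
    proof -
      have "Suc n - i \<in> {1..n}" using i by auto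
      from \<sigma>in[OF this] have "\<rho> i = Suc n - \<sigma> (Suc n - i)" "\<sigma> (Suc n - i) \<le> n"
        using i by (auto simp: \<rho>_def rv_def)
      then show ?thesis using g by simp
    qed
    have inc: "\<kappa> i \<le> \<kappa> (Suc i)" if i: "i \<in> {1..<n}" for i
    proof -
      have "g (\<sigma> (Suc n - i)) < g (\<sigma> (Suc n - Suc i))" by (rule dec) (use i in auto)
      then show ?thesis using x\<rho>[of i] x\<rho>[of "Suc i"] i by (simp add: \<kappa>_def)
    qed
    have pos: "0 \<le> \<kappa> i + int p" if i: "i \<in> {1..n}" for i
    proof -
      have "\<kappa> 1 \<le> \<kappa> i"
        using i
      proof (induction i)
        case (Suc j)
        show ?case
        proof (cases "j = 0")
          case False
          then show ?thesis using Suc inc[of j] by auto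
        qed simp
      qed simp
      moreover have "\<kappa> 1 = g (\<sigma> n) + int n" using x\<rho>[of 1] i by (simp add: \<kappa>_def)
      ultimately show ?thesis by (simp add: p_def)
    qed
    have mu: "int (mu i) = \<kappa> (Suc n - i) + int p" if i: "i \<in> {1..n}" for i
    proof -
      have "Suc n - i \<in> {1..n}" using i by auto
      moreover from x\<rho>[OF this] have "\<kappa> (Suc n - i) = g (\<sigma> i) + int i"
        using i by (simp add: \<kappa>_def of_nat_diff)
      ultimately show ?thesis using pos[of "Suc n - i"] by (simp add: mu_def)
    qed
    have "asch n X (\<lambda>i. \<kappa> i + int i) = schur n mu X * (\<Prod>i=1..n. X i powi (- int p))"
      by (rule asch_eq_schur) (use inc pos mu X in auto)
    moreover have "(\<lambda>i. \<kappa> i + int i) = x \<circ> \<rho>" by (auto simp: \<kappa>_def)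
    moreover have "asch n X (x \<circ> \<rho>) = of_int (sign \<sigma>) * asch n X x"
      using alternating_permutes[OF alternating_asch \<rho>, of X x] sgn by simp
    ultimately have "of_int (sign \<sigma>) * asch n X x = schur n mu X * (\<Prod>i=1..n. X i powi (- int p))"
      by simp
    moreover have "of_int (sign \<sigma>) * (of_int (sign \<sigma>) * asch n X x) = asch n X x"
      by (simp add: sign_def)
    ultimately have "asch n X x = of_int (sign \<sigma>) * (schur n mu X * (\<Prod>i=1..n. X i powi (- int p)))"
      by (simp only:)
    then show ?thesis
      using ext by (simp add: x_def[abs_def] lam_def[abs_def] mult.assoc)
  qed
qed

theorem mainTheorem6:
  fixes n :: nat and k :: "nat \<Rightarrow> int" and u v w :: "'a::field" and X :: "nat \<Rightarrow> 'a"
  assumes "\<forall>i. 1 \<le> i \<and> i < n \<longrightarrow> k i < k (i+1)"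
    and "\<forall>i. 1 \<le> i \<and> i \<le> n \<longrightarrow> X i \<noteq> 0"
  shows "(\<Sum>M\<in>{M. monotone_triangle n k M}. W0 n u v w X M)
         = op_product n u v w (\<lambda>m. ext_schur n (\<lambda>i. m (n + 1 - i)) X) k"
proof -
  have "(\<Sum>M\<in>{M. monotone_triangle n k M}. W0 n u v w X M) = opsch u v w n X k"
    by (rule sum_W0_eq_opsch) (use assms in auto)
  \<comment> \<open>Translating the argument by \<open>int i\<close> commutes with every
    shift.\<close>
  also have "\<dots> = act (opR_prod u v w n) (\<lambda>m. asch n X (\<lambda>i. m i + int i)) k"
    unfolding opsch_def act_def by (simp add: plus_fun_def algebra_simps)
  also have "\<dots> = op_product n u v w (\<lambda>m. ext_schur n (\<lambda>i. m (n + 1 - i)) X) k"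
    unfolding op_product_eq_act ext_schur_eq_asch[OF assms(2)] ..
  finally show ?thesis .
qed

end
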